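(* Let $Q\subseteq\mathbb{R}^{n}$ be a compact semialgebraic set (with the metric induced from $\mathbb{R}^n$), and consider the system of linear equations $$A(x)\phi(x)=\gamma(x),\qquad x\in Q,$$ where $A(x)=(a_{ij}(x))\in M_{r,s}(\mathbb{R})$ is a real $r\times s$ matrix and $\gamma(x)=(\gamma_i(x))\in\mathbb{R}^{r}$, and all the entries $a_{ij}$ and $\gamma_i$ are semialgebraic (not necessarily continuous) functions on $\mathbb{R}^{n}$. Then there exists a continuous semialgebraic function $\phi:Q\to\mathbb{R}^{s}$ with $A(x)\phi(x)=\gamma(x)$ for all $x\in Q$ if and only if there exists a continuous function $\psi:Q\to\mathbb{R}^{s}$ with $A(x)\psi(x)=\gamma(x)$ for all $x\in Q$.
   Context: A function between subsets of Euclidean spaces is semialgebraic if its graph is a semialgebraic set. All spaces $\mathbb{R}^s$ carry the Euclidean norm. *)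

theory Defs
  imports "HOL-Analysis.Analysis"
begin

text \<open>The semialgebraic subsets of a Euclidean space are the smallest class that contains all
  sets given by a strict polynomial inequality and is closed under finite Boolean combinations.
  Sets defined by polynomial equations belong to it, as the common complement of
  \<open>p > 0\<close> and \<open>- p > 0\<close>.\<close>

inductive semialgebraic :: "'a::euclidean_space set \<Rightarrow> bool" where
  pos: "real_polynomial_function p \<Longrightarrow> semialgebraic {x. p x > 0}"
| Un: "semialgebraic S \<Longrightarrow> semialgebraic T \<Longrightarrow> semialgebraic (S \<union> T)"
| Int: "semialgebraic S \<Longrightarrow> semialgebraic T \<Longrightarrow> semialgebraic (S \<inter> T)"
| Compl: "semialgebraic S \<Longrightarrow> semialgebraic (- S)"

definition semialgebraic_on ::
    "'a::euclidean_space set \<Rightarrow> ('a \<Rightarrow> 'b::euclidean_space) \<Rightarrow> bool" where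
  "semialgebraic_on S f \<longleftrightarrow> semialgebraic {(x, f x) | x. x \<in> S}"

end

(*
  A continuous solution is a continuous section of the bundle H of affine solution spaces
  H x = {v. A x v = gamma x} over Q.  The Glaeser refinement of a bundle keeps the points v of H x
  that are limits of points of H y as y tends to x in Q.  It is definable by a first-order formula,
  so it preserves semialgebraicity (Tarski-Seidenberg), and it loses no continuous section.  A
  dimension count shows that it becomes stationary after 2 s + 3 steps; the stable bundle K is lower
  semicontinuous, and its fibres are nonempty as soon as some continuous solution exists.

  A lower semicontinuous bundle K of affine spaces has a continuous semialgebraic section: the points
  of a closed set E at which K restricted to E fails to be upper semicontinuous have a closure E' in
  E on which the maximal fibre dimension is smaller.  Extend a section over E' by a semialgebraic
  version of Tietze's theorem and project the extension orthogonally to the fibres.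

  For Tarski-Seidenberg, a finite family of polynomials in t with piecewise rational coefficients is
  shown to have finitely many sign diagrams, each on a semialgebraic set of parameters, by the
  Cohen-Hoermander induction: the diagram of p is determined by those of p', of the other members
  and of the remainders of p modulo all of these.
*)
theory Submission
  imports Defs
begin

section \<open>The Tarski-Seidenberg theorem\<close>

text \<open>The given continuous solution need not be semialgebraic; it only shows that the stable
  fibres are nonempty. The count 2 s + 3 arises from two steps per dimension: after 2 j + 1
  refinements a fibre of dimension at least s - j is final, and j = s + 1 admits dimension -1, the
  empty fibre. Behind this is that a lower limit of affine spaces has at most the dimension of the
  nearby spaces, because a slightly perturbed basis stays independent. Applied along a sequence, the
  same fact turns lower semicontinuity with locally constant dimension into upper semicontinuity.
  The obstacle to selection is that nearest points in the fibres may jump where upper semicontinuity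
  fails. There lower semicontinuity still suffices if the function being projected already lies in
  the fibre, hence the section over E' comes first. In the elimination, two parameters share a sign
  diagram if one increasing bijection of the line matches all signs. Such a bijection can be
  repaired root by root, and it carries witnesses along. Coefficients are only piecewise rational
  because division has to follow a degree that varies with the parameter.\<close>

text \<open>A finite cover with possibly overlapping pieces: the properties of interest pass to
  smaller sets, so two covers are combined by intersecting their members.\<close>

definition piecewise :: "('a::euclidean_space set \<Rightarrow> bool) \<Rightarrow> bool" where
  "piecewise R \<longleftrightarrow> (\<exists>C. finite C \<and> \<Union>C = UNIV \<and> (\<forall>S\<in>C. semialgebraic S \<and> R S))"

lemma semialgebraic_UNIV [simp]: "semialgebraic (UNIV :: 'a::euclidean_space set)"
  using semialgebraic.pos[of "\<lambda>x::'a. 1"] by (simp add: real_polynomial_function.intros(2))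

lemma semialgebraic_empty [simp]: "semialgebraic ({} :: 'a::euclidean_space set)"
  using semialgebraic.Compl[OF semialgebraic_UNIV] by simp

lemma semialgebraic_Union:
  assumes "finite C" "\<And>S. S \<in> C \<Longrightarrow> semialgebraic S"
  shows "semialgebraic (\<Union>C)"
  using assms by (induction C rule: finite_induct) (auto intro: semialgebraic.Un)

lemma semialgebraic_UN:
  assumes "finite I" "\<And>i. i \<in> I \<Longrightarrow> semialgebraic (S i)"
  shows "semialgebraic (\<Union>i\<in>I. S i)"
  using assms by (intro semialgebraic_Union) auto

lemma semialgebraic_Collect_not: "semialgebraic {x. P x} \<Longrightarrow> semialgebraic {x. \<not> P x}"
  using semialgebraic.Compl[of "{x. P x}"] by (simp add: Compl_eq)

lemma semialgebraic_Collect_conj: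
  "semialgebraic {x. P x} \<Longrightarrow> semialgebraic {x. Q x} \<Longrightarrow> semialgebraic {x. P x \<and> Q x}"
  using semialgebraic.Int[of "{x. P x}" "{x. Q x}"] by (simp add: Collect_conj_eq)

lemma semialgebraic_Collect_disj:
  "semialgebraic {x. P x} \<Longrightarrow> semialgebraic {x. Q x} \<Longrightarrow> semialgebraic {x. P x \<or> Q x}"
  using semialgebraic.Un[of "{x. P x}" "{x. Q x}"] by (simp add: Collect_disj_eq)

lemma semialgebraic_Collect_imp:
  "semialgebraic {x. P x} \<Longrightarrow> semialgebraic {x. Q x} \<Longrightarrow> semialgebraic {x. P x \<longrightarrow> Q x}"
  unfolding imp_conv_disj by (intro semialgebraic_Collect_disj semialgebraic_Collect_not)

lemma piecewise_combine:
  assumes "piecewise R1" "piecewise R2" "\<And>S T. R1 S \<Longrightarrow> R2 T \<Longrightarrow> R (S \<inter> T)"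
  shows "piecewise R"
proof -
  obtain C D where C: "finite C" "\<Union>C = UNIV" "\<And>S. S \<in> C \<Longrightarrow> semialgebraic S \<and> R1 S"
    and D: "finite D" "\<Union>D = UNIV" "\<And>S. S \<in> D \<Longrightarrow> semialgebraic S \<and> R2 S"
    using assms(1,2) unfolding piecewise_def by metis
  let ?E = "(\<lambda>(S, T). S \<inter> T) ` (C \<times> D)"
  have "finite ?E" using C(1) D(1) by auto
  moreover have "x \<in> \<Union>?E" for x
  proof -
    obtain S T where "S \<in> C" "T \<in> D" "x \<in> S" "x \<in> T" using C(2) D(2) by blast
    then show ?thesis by force
  qed
  moreover have "\<forall>S\<in>?E. semialgebraic S \<and> R S"
    using C(3) D(3) assms(3) by (auto intro: semialgebraic.Int)
  ultimately show ?thesis unfolding piecewise_def by blast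
qed

lemma piecewise_mono: "piecewise R1 \<Longrightarrow> (\<And>S. R1 S \<Longrightarrow> R S) \<Longrightarrow> piecewise R"
  unfolding piecewise_def by meson

lemma piecewise_split:
  assumes "semialgebraic T"
  shows "piecewise (\<lambda>S. S \<subseteq> T \<or> S \<subseteq> - T)"
proof -
  have "finite {T, - T}" "\<Union>{T, - T} = UNIV" by auto
  then show ?thesis unfolding piecewise_def
    by (intro exI[of _ "{T, - T}"]) (use assms semialgebraic.Compl[OF assms] in auto)
qed

lemma semialgebraic_piecewise:
  assumes "piecewise R" "\<And>S. semialgebraic S \<Longrightarrow> R S \<Longrightarrow> semialgebraic (S \<inter> X)"
  shows "semialgebraic X"
proof -
  obtain C where C: "finite C" "\<Union>C = UNIV" "\<And>S. S \<in> C \<Longrightarrow> semialgebraic S \<and> R S"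
    using assms(1) unfolding piecewise_def by metis
  have "X = (\<Union>S\<in>C. S \<inter> X)" using C(2) by auto
  also have "semialgebraic \<dots>" using C assms(2) by (intro semialgebraic_UN) auto
  finally show ?thesis .
qed

section \<open>Piecewise rational functions of the parameter\<close>

definition rational_on :: "('a::euclidean_space \<Rightarrow> real) \<Rightarrow> 'a set \<Rightarrow> bool" where
  "rational_on f S \<longleftrightarrow> (\<exists>p q. real_polynomial_function p \<and> real_polynomial_function q \<and>
      (\<forall>x\<in>S. q x \<noteq> 0 \<and> f x = p x / q x))"

definition pw_rational :: "('a::euclidean_space \<Rightarrow> real) \<Rightarrow> bool" where
  "pw_rational f \<longleftrightarrow> piecewise (rational_on f)"

lemma piecewise_trivial: "R UNIV \<Longrightarrow> piecewise R"
  unfolding piecewise_def by (intro exI[of _ "{UNIV}"]) simp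

lemma rational_on_subset: "rational_on f S \<Longrightarrow> T \<subseteq> S \<Longrightarrow> rational_on f T"
  unfolding rational_on_def by (meson subsetD)

lemma rational_on_cong: "rational_on f S \<Longrightarrow> (\<And>x. x \<in> S \<Longrightarrow> g x = f x) \<Longrightarrow> rational_on g S"
  unfolding rational_on_def by (metis (no_types, lifting))

lemma pw_rational_poly: "real_polynomial_function p \<Longrightarrow> pw_rational p"
  unfolding pw_rational_def
  by (intro piecewise_trivial)
    (force simp: rational_on_def intro: exI[of _ p] exI[of _ "\<lambda>_. 1"] real_polynomial_function.intros(2))

lemma pw_rational_const: "pw_rational (\<lambda>_. c)"
  by (intro pw_rational_poly real_polynomial_function.intros(2))

lemma pw_rational_add:
  assumes "pw_rational f" "pw_rational g"
  shows "pw_rational (\<lambda>x. f x + g x)"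
  unfolding pw_rational_def
proof (rule piecewise_combine[OF assms[unfolded pw_rational_def]])
  fix S T assume "rational_on f S" "rational_on g T"
  then obtain p q p' q' where *: "real_polynomial_function p" "real_polynomial_function q"
    "real_polynomial_function p'" "real_polynomial_function q'"
    "\<forall>x\<in>S. q x \<noteq> 0 \<and> f x = p x / q x" "\<forall>x\<in>T. q' x \<noteq> 0 \<and> g x = p' x / q' x"
    unfolding rational_on_def by metis
  then show "rational_on (\<lambda>x. f x + g x) (S \<inter> T)"
    unfolding rational_on_def
    by (intro exI[of _ "\<lambda>x. p x * q' x + p' x * q x"] exI[of _ "\<lambda>x. q x * q' x"])
      (auto intro!: real_polynomial_function.intros(2-) simp: field_simps)
qed

lemma pw_rational_mult:
  assumes "pw_rational f" "pw_rational g"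
  shows "pw_rational (\<lambda>x. f x * g x)"
  unfolding pw_rational_def
proof (rule piecewise_combine[OF assms[unfolded pw_rational_def]])
  fix S T assume "rational_on f S" "rational_on g T"
  then obtain p q p' q' where *: "real_polynomial_function p" "real_polynomial_function q"
    "real_polynomial_function p'" "real_polynomial_function q'"
    "\<forall>x\<in>S. q x \<noteq> 0 \<and> f x = p x / q x" "\<forall>x\<in>T. q' x \<noteq> 0 \<and> g x = p' x / q' x"
    unfolding rational_on_def by metis
  then show "rational_on (\<lambda>x. f x * g x) (S \<inter> T)"
    unfolding rational_on_def
    by (intro exI[of _ "\<lambda>x. p x * p' x"] exI[of _ "\<lambda>x. q x * q' x"])
      (auto intro!: real_polynomial_function.intros(2-) simp: field_simps)
qed

lemma pw_rational_uminus: "pw_rational f \<Longrightarrow> pw_rational (\<lambda>x. - f x)"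
  using pw_rational_mult[OF pw_rational_const[of "-1"]] by fastforce

lemma pw_rational_diff: "pw_rational f \<Longrightarrow> pw_rational g \<Longrightarrow> pw_rational (\<lambda>x. f x - g x)"
  using pw_rational_add[OF _ pw_rational_uminus] by fastforce

lemma pw_rational_sum:
  "finite I \<Longrightarrow> (\<And>i. i \<in> I \<Longrightarrow> pw_rational (f i)) \<Longrightarrow> pw_rational (\<lambda>x. \<Sum>i\<in>I. f i x)"
  by (induction I rule: finite_induct) (auto intro: pw_rational_const pw_rational_add)

text \<open>On a piece, the quotient of \<open>p\<close> and \<open>q\<close> has the sign of the
  product of \<open>p\<close> and \<open>q\<close>, which is a polynomial.\<close>

lemma semialgebraic_pw_pos:
  assumes "pw_rational f"
  shows "semialgebraic {x. f x > 0}"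
proof (rule semialgebraic_piecewise[OF assms[unfolded pw_rational_def]])
  fix S :: "'a set" assume S: "semialgebraic S" "rational_on f S"
  then obtain p q where *: "real_polynomial_function p" "real_polynomial_function q"
    "\<forall>x\<in>S. q x \<noteq> 0 \<and> f x = p x / q x"
    unfolding rational_on_def by metis
  have "S \<inter> {x. f x > 0} = S \<inter> {x. p x * q x > 0}"
    using *(3) by (auto simp: zero_less_divide_iff zero_less_mult_iff)
  then show "semialgebraic (S \<inter> {x. f x > 0})"
    using S(1) * by (auto intro!: semialgebraic.intros real_polynomial_function.intros(2-))
qed

lemma semialgebraic_pw_eq_0:
  assumes "pw_rational f"
  shows "semialgebraic {x. f x = 0}"
proof -
  have "{x. f x = 0} = - ({x. f x > 0} \<union> {x. - f x > 0})" by auto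
  then show ?thesis
    using semialgebraic_pw_pos[OF assms] semialgebraic_pw_pos[OF pw_rational_uminus[OF assms]]
    by (auto intro!: semialgebraic.intros)
qed

lemma pw_rational_if:
  assumes "semialgebraic {x. P x}" "pw_rational f" "pw_rational g"
  shows "pw_rational (\<lambda>x. if P x then f x else g x)"
  unfolding pw_rational_def
proof (rule piecewise_combine[OF piecewise_split[OF assms(1)]
      piecewise_combine[OF assms(2,3)[unfolded pw_rational_def]]])
  show "rational_on f (S \<inter> T) \<and> rational_on g (S \<inter> T)"
    if "rational_on f S" "rational_on g T" for S T
    using that by (auto intro: rational_on_subset)
next
  fix S T assume "S \<subseteq> {x. P x} \<or> S \<subseteq> - {x. P x}" "rational_on f T \<and> rational_on g T"
  then have "rational_on f (S \<inter> T)" "rational_on g (S \<inter> T)"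
    "S \<subseteq> {x. P x} \<or> S \<subseteq> - {x. P x}" by (auto intro: rational_on_subset)
  then show "rational_on (\<lambda>x. if P x then f x else g x) (S \<inter> T)"
    by (elim disjE) (erule rational_on_cong; auto)+
qed

lemma pw_rational_inverse:
  assumes "pw_rational f"
  shows "pw_rational (\<lambda>x. inverse (f x))"
  unfolding pw_rational_def
proof (rule piecewise_combine[OF piecewise_split[OF semialgebraic_pw_eq_0[OF assms]]
      assms[unfolded pw_rational_def]])
  fix S T assume S: "S \<subseteq> {x. f x = 0} \<or> S \<subseteq> - {x. f x = 0}" and "rational_on f T"
  then obtain p q where *: "real_polynomial_function p" "real_polynomial_function q"
    "\<forall>x\<in>T. q x \<noteq> 0 \<and> f x = p x / q x"
    unfolding rational_on_def by metis
  from S show "rational_on (\<lambda>x. inverse (f x)) (S \<inter> T)"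
  proof
    \<comment> \<open>Here the convention \<open>inverse 0 = 0\<close> makes the inverse the
      constant 0, so the inverse is piecewise rational as a total function.\<close>
    assume "S \<subseteq> {x. f x = 0}"
    then show ?thesis unfolding rational_on_def
      by (intro exI[of _ "\<lambda>x. 0"] exI[of _ "\<lambda>x. 1"])
        (auto intro: real_polynomial_function.intros)
  next
    assume "S \<subseteq> - {x. f x = 0}"
    then show ?thesis unfolding rational_on_def
      using * by (intro exI[of _ q] exI[of _ p]) auto
  qed
qed

lemma pw_rational_divide: "pw_rational f \<Longrightarrow> pw_rational g \<Longrightarrow> pw_rational (\<lambda>x. f x / g x)"
  unfolding divide_inverse by (intro pw_rational_mult pw_rational_inverse)

section \<open>Univariate polynomials depending on a parameter\<close>

text \<open>The number \<open>d\<close> is only a uniform bound. The true degree may drop at some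
  parameters, but the set where it takes a given value is semialgebraic, so case distinctions on it
  stay within the class.\<close>

definition pw_poly :: "nat \<Rightarrow> ('a::euclidean_space \<Rightarrow> real poly) \<Rightarrow> bool" where
  "pw_poly d P \<longleftrightarrow> (\<forall>x. degree (P x) \<le> d) \<and> (\<forall>i. pw_rational (\<lambda>x. coeff (P x) i))"

lemma pw_poly_mono: "pw_poly d P \<Longrightarrow> d \<le> e \<Longrightarrow> pw_poly e P"
  unfolding pw_poly_def using order_trans by blast

lemma semialgebraic_degree_le:
  assumes "pw_poly d P"
  shows "semialgebraic {x. degree (P x) \<le> n}"
proof -
  have "degree (P x) \<le> n \<longleftrightarrow> (\<forall>i\<in>{n<..d}. coeff (P x) i = 0)" for x
    using assms unfolding pw_poly_def
    by (metis coeff_eq_0 degree_le greaterThanAtMost_iff le_degree le_less_trans linorder_not_le)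
  then have "{x. degree (P x) \<le> n} = - (\<Union>i\<in>{n<..d}. - {x. coeff (P x) i = 0})" by auto
  moreover have "semialgebraic (- (\<Union>i\<in>{n<..d}. - {x. coeff (P x) i = 0}))"
    using assms
    by (intro semialgebraic_UN semialgebraic.Compl semialgebraic_pw_eq_0) (auto simp: pw_poly_def)
  ultimately show ?thesis by simp
qed

lemma semialgebraic_degree_eq:
  assumes "pw_poly d P"
  shows "semialgebraic {x. degree (P x) = n}"
proof (cases n)
  case 0
  then show ?thesis using semialgebraic_degree_le[OF assms, of 0] by simp
next
  case (Suc m)
  have "{x. degree (P x) = n} = {x. degree (P x) \<le> n} \<inter> - {x. degree (P x) \<le> m}"
    using Suc by auto
  then show ?thesis
    using semialgebraic_degree_le[OF assms] by (auto intro: semialgebraic.intros)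
qed

lemma semialgebraic_poly_eq_0:
  assumes "pw_poly d P"
  shows "semialgebraic {x. P x = 0}"
proof -
  have "{x. P x = 0} = {x. degree (P x) \<le> 0} \<inter> {x. coeff (P x) 0 = 0}"
    by (auto elim!: degree_eq_zeroE)
  then show ?thesis using semialgebraic_degree_le[OF assms, of 0] assms
    by (auto intro!: semialgebraic.Int semialgebraic_pw_eq_0 simp: pw_poly_def)
qed

lemma pw_poly_if:
  assumes "semialgebraic {x. R x}" "pw_poly d P" "pw_poly d Q"
  shows "pw_poly d (\<lambda>x. if R x then P x else Q x)"
  using assms pw_rational_if[OF assms(1)] unfolding pw_poly_def by (auto simp: if_distrib[of "\<lambda>p. coeff p _"])

lemma pw_poly_add: "pw_poly d P \<Longrightarrow> pw_poly e Q \<Longrightarrow> pw_poly (max d e) (\<lambda>x. P x + Q x)"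
  unfolding pw_poly_def by (auto intro!: pw_rational_add degree_add_le intro: max.coboundedI1 max.coboundedI2)

lemma pw_poly_diff: "pw_poly d P \<Longrightarrow> pw_poly e Q \<Longrightarrow> pw_poly (max d e) (\<lambda>x. P x - Q x)"
  unfolding pw_poly_def by (auto intro!: pw_rational_diff degree_diff_le intro: max.coboundedI1 max.coboundedI2)

lemma pw_poly_mult: "pw_poly d P \<Longrightarrow> pw_poly e Q \<Longrightarrow> pw_poly (d + e) (\<lambda>x. P x * Q x)"
  unfolding pw_poly_def
  by (auto simp: coeff_mult intro!: pw_rational_sum pw_rational_mult
      order_trans[OF degree_mult_le] add_mono)

lemma pw_poly_monom: "pw_rational f \<Longrightarrow> pw_poly n (\<lambda>x. monom (f x) n)"
  unfolding pw_poly_def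
proof (intro conjI allI)
  fix i assume "pw_rational f"
  then show "pw_rational (\<lambda>x. coeff (monom (f x) n) i)"
    by (cases "i = n") (auto intro: pw_rational_const)
qed (simp add: degree_monom_le)

lemma pw_poly_const: "pw_rational f \<Longrightarrow> pw_poly 0 (\<lambda>x. [:f x:])"
  using pw_poly_monom[of f 0] by (simp add: monom_0)

lemma pw_poly_pderiv: "pw_poly (Suc d) P \<Longrightarrow> pw_poly d (\<lambda>x. pderiv (P x))"
  unfolding pw_poly_def
  by (auto simp: coeff_pderiv degree_pderiv intro!: pw_rational_mult pw_rational_const
      intro: le_diff_conv[THEN iffD2])

lemma pw_poly_degree_pred:
  "pw_poly e P \<Longrightarrow> (\<And>x. degree (P x) \<le> d) \<Longrightarrow> pw_poly d P"
  unfolding pw_poly_def by auto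

section \<open>Signs of a real polynomial between and beyond given roots\<close>

lemma finite_gap:
  fixes t :: "'a::linorder"
  assumes "finite N" "t \<notin> N" "a \<in> N" "b \<in> N" "a < t" "t < b"
  obtains t1 t2 where "t1 \<in> N" "t2 \<in> N" "t1 < t" "t < t2" "{t1<..<t2} \<inter> N = {}"
proof
  let ?L = "{n\<in>N. n < t}" and ?U = "{n\<in>N. t < n}"
  have L: "finite ?L" "?L \<noteq> {}" and U: "finite ?U" "?U \<noteq> {}" using assms by auto
  have 1: "Max ?L \<in> ?L" "Min ?U \<in> ?U" using Max_in[OF L] Min_in[OF U] by auto
  then show "Max ?L \<in> N" "Min ?U \<in> N" "Max ?L < t" "t < Min ?U" by auto
  show "{Max ?L<..<Min ?U} \<inter> N = {}"
  proof (intro equals0I, elim IntE)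
    fix x assume x: "x \<in> {Max ?L<..<Min ?U}" "x \<in> N"
    then consider "x < t" | "x > t" using assms(2) by (cases x t rule: linorder_cases) auto
    then show False
    proof cases
      case 1
      then have "x \<le> Max ?L" using x L by (intro Max_ge) auto
      then show ?thesis using x by auto
    next
      case 2
      then have "Min ?U \<le> x" using x U by (intro Min_le) auto
      then show ?thesis using x by auto
    qed
  qed
qed

lemma sgn_poly_const:
  fixes p :: "real poly"
  assumes "\<And>z. z \<in> {u..v} \<union> {v..u} \<Longrightarrow> poly p z \<noteq> 0"
  shows "sgn (poly p u) = sgn (poly p v)"
proof (rule ccontr)
  assume *: "sgn (poly p u) \<noteq> sgn (poly p v)"
  have nz: "poly p u \<noteq> 0" "poly p v \<noteq> 0" using assms by (auto simp: linear)
  then have neg: "poly p u * poly p v < 0"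
    using * by (auto simp: sgn_if mult_less_0_iff split: if_splits)
  have "u \<noteq> v" using * by auto
  then consider "u < v" | "v < u" by linarith
  then show False
  proof cases
    case 1 then show ?thesis using poly_IVT[OF 1 neg] assms by force
  next
    case 2 then show ?thesis using poly_IVT[OF 2] neg assms by (force simp: mult.commute)
  qed
qed

lemma poly_unbounded:
  fixes p :: "real poly"
  assumes "degree p > 0"
  obtains C where "\<And>t. \<bar>t\<bar> \<ge> C \<Longrightarrow> \<bar>poly p t\<bar> > B"
proof -
  have "filterlim (poly p) at_infinity at_infinity"
    by (rule filterlim_poly_at_infinity[OF assms])
  then have "eventually (\<lambda>t. \<bar>poly p t\<bar> \<ge> \<bar>B\<bar> + 1) at_infinity"
    by (subst (asm) filterlim_at_infinity[of 0]) (auto dest: spec[of _ "\<bar>B\<bar> + 1"])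
  then obtain C where "\<And>t. \<bar>t\<bar> \<ge> C \<Longrightarrow> \<bar>poly p t\<bar> \<ge> \<bar>B\<bar> + 1"
    unfolding eventually_at_infinity by auto
  then show ?thesis by (intro that[of C]) force
qed

text \<open>Far to the left, \<open>p\<close> exceeds its value at \<open>t\<close> in absolute
  value without having changed sign. The mean value theorem between such a point and
  \<open>t\<close> then gives \<open>pderiv p\<close> the opposite sign.\<close>

lemma sgn_poly_below_roots:
  fixes p :: "real poly"
  assumes "degree p > 0"
    and p: "\<And>z. z \<le> t \<Longrightarrow> poly p z \<noteq> 0" and p': "\<And>z. z \<le> t \<Longrightarrow> poly (pderiv p) z \<noteq> 0"
  shows "sgn (poly p t) = - sgn (poly (pderiv p) t)"
proof -
  obtain C where C: "\<And>z. \<bar>z\<bar> \<ge> C \<Longrightarrow> \<bar>poly p z\<bar> > \<bar>poly p t\<bar>"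
    using poly_unbounded[OF assms(1), of "\<bar>poly p t\<bar>"] by auto
  define z where "z = min (t - 1) (- \<bar>C\<bar>)"
  have z: "z < t" "\<bar>poly p z\<bar> > \<bar>poly p t\<bar>" unfolding z_def by (auto intro!: C)
  obtain c where c: "z < c" "c < t" "poly p t - poly p z = (t - z) * poly (pderiv p) c"
    using poly_MVT[OF z(1)] by auto
  have "sgn (poly p z) = sgn (poly p t)" using z p by (intro sgn_poly_const) auto
  moreover have "sgn (poly (pderiv p) c) = sgn (poly (pderiv p) t)"
    using c p' by (intro sgn_poly_const) auto
  moreover have "sgn (poly p t - poly p z) = sgn (poly (pderiv p) c)"
    using c z by (simp add: sgn_mult)
  ultimately show ?thesis using z(2) by (auto simp: sgn_if split: if_splits)
qed

lemma sgn_poly_above_roots: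
  fixes p :: "real poly"
  assumes "degree p > 0"
    and p: "\<And>z. z \<ge> t \<Longrightarrow> poly p z \<noteq> 0" and p': "\<And>z. z \<ge> t \<Longrightarrow> poly (pderiv p) z \<noteq> 0"
  shows "sgn (poly p t) = sgn (poly (pderiv p) t)"
proof -
  obtain C where C: "\<And>z. \<bar>z\<bar> \<ge> C \<Longrightarrow> \<bar>poly p z\<bar> > \<bar>poly p t\<bar>"
    using poly_unbounded[OF assms(1), of "\<bar>poly p t\<bar>"] by auto
  define z where "z = max (t + 1) \<bar>C\<bar>"
  have z: "t < z" "\<bar>poly p z\<bar> > \<bar>poly p t\<bar>" unfolding z_def by (auto intro!: C)
  obtain c where c: "t < c" "c < z" "poly p z - poly p t = (z - t) * poly (pderiv p) c"
    using poly_MVT[OF z(1)] by auto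
  have "sgn (poly p z) = sgn (poly p t)" using z p by (intro sgn_poly_const) auto
  moreover have "sgn (poly (pderiv p) c) = sgn (poly (pderiv p) t)"
    using c p' by (intro sgn_poly_const) auto
  moreover have "sgn (poly p z - poly p t) = sgn (poly (pderiv p) c)"
    using c z by (simp add: sgn_mult)
  ultimately show ?thesis using z(2) by (auto simp: sgn_if split: if_splits)
qed

section \<open>Matching sign diagrams by increasing bijections\<close>

text \<open>With \<open>h\<close> an increasing bijection of the line this says that
  \<open>p\<close> and \<open>q\<close> have the same sign diagram. The bijection replaces explicit
  ordered lists of roots and signs, and one \<open>h\<close> can serve a whole family.\<close>

definition same_signs :: "(real \<Rightarrow> real) \<Rightarrow> real poly \<Rightarrow> real poly \<Rightarrow> bool" where
  "same_signs h p q \<longleftrightarrow> (\<forall>t. sgn (poly p t) = sgn (poly q (h t)))"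

lemma sgn_diff_root_in_gap:
  fixes p :: "real poly"
  assumes "r \<in> {t1..t2}" "t \<in> {t1..t2}" and p': "\<And>z. z \<in> {t1<..<t2} \<Longrightarrow> sgn (poly (pderiv p) z) = s"
  shows "sgn (poly p t - poly p r) = s * sgn (t - r)"
proof (cases r t rule: linorder_cases)
  case less
  obtain z where z: "z > r" "z < t" "poly p t - poly p r = (t - r) * poly (pderiv p) z"
    using poly_MVT[OF less] by auto
  then have "sgn (poly (pderiv p) z) = s" using assms by (intro p') auto
  then show ?thesis using z by (simp add: sgn_mult)
next
  case greater
  obtain z where z: "z > t" "z < r" "poly p r - poly p t = (r - t) * poly (pderiv p) z"
    using poly_MVT[OF greater] by auto
  then have "sgn (poly (pderiv p) z) = s" using assms by (intro p') auto
  moreover have "poly p t - poly p r = (t - r) * poly (pderiv p) z" using z by (simp add: algebra_simps)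
  ultimately show ?thesis by (simp add: sgn_mult)
qed simp

text \<open>The signs at the end points of a gap and the monotonicity of \<open>q\<close> on it determine the sign
  of \<open>q\<close> in between.\<close>

lemma sgn_agree_gap:
  fixes p q :: "real poly"
  assumes h: "strict_mono h" and t: "t1 < t" "t < t2"
    and p': "\<And>z. z \<in> {t1<..<t2} \<Longrightarrow> sgn (poly (pderiv p) z) = s"
    and q': "\<And>z. z \<in> {h t1<..<h t2} \<Longrightarrow> sgn (poly (pderiv q) z) = s"
    and s: "s = 1 \<or> s = -1"
    and ends: "sgn (poly p t1) = sgn (poly q (h t1))" "sgn (poly p t2) = sgn (poly q (h t2))"
    and roots: "\<And>r. r \<in> {t1<..<t2} \<Longrightarrow> poly p r = 0 \<Longrightarrow> poly q (h r) = 0"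
  shows "sgn (poly p t) = sgn (poly q (h t))"
proof (cases "\<exists>r\<in>{t1<..<t2}. poly p r = 0")
  case True
  then obtain r where r: "t1 < r" "r < t2" "poly p r = 0" "poly q (h r) = 0" using roots by auto
  have "sgn (poly p t - poly p r) = s * sgn (t - r)"
    using r t by (intro sgn_diff_root_in_gap[OF _ _ p']) auto
  moreover have "sgn (poly q (h t) - poly q (h r)) = s * sgn (h t - h r)"
    using r t strict_mono_less_eq[OF h] by (intro sgn_diff_root_in_gap[OF _ _ q']) auto
  moreover have "sgn (h t - h r) = sgn (t - r)"
    using strict_mono_less[OF h] strict_mono_eq[OF h] by (simp add: sgn_if)
  ultimately show ?thesis using r by simp
next
  case False
  have nz: "poly p t \<noteq> 0" using False t by auto
  have ht: "h t1 < h t" "h t < h t2" using strict_mono_less[OF h] t by auto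
  have P: "sgn (poly p t - poly p t1) = s" "sgn (poly p t2 - poly p t) = s"
    using sgn_diff_root_in_gap[of t1 t1 t2 t p s] sgn_diff_root_in_gap[of t t1 t2 t2 p s] p' t by auto
  have Q: "sgn (poly q (h t) - poly q (h t1)) = s" "sgn (poly q (h t2) - poly q (h t)) = s"
    using sgn_diff_root_in_gap[of "h t1" "h t1" "h t2" "h t" q s]
      sgn_diff_root_in_gap[of "h t" "h t1" "h t2" "h t2" q s] q' ht by auto
  have E1: "\<not> poly p t1 * poly p t < 0"
    using poly_IVT[OF t(1)] False t by force
  have E2: "\<not> poly p t * poly p t2 < 0"
    using poly_IVT[OF t(2)] False t by force
  show ?thesis
    using s nz P Q E1 E2 ends
    by (auto simp: sgn_if mult_less_0_iff split: if_splits)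
qed

text \<open>Add to the identity a multiple of the tent function \<open>T\<close> that is 1 at
  \<open>r\<close> and 0 outside the gap. On the side where the perturbation decreases, its slope is
  below 1 in absolute value because \<open>r'\<close> also lies in the gap, so \<open>m\<close>
  stays strictly increasing.\<close>

lemma reparam_gap:
  fixes u v r r' :: real
  assumes "u < r" "r < v" "u < r'" "r' < v"
  obtains m where "strict_mono m" "surj m" "m r = r'" "\<And>t. t \<notin> {u<..<v} \<Longrightarrow> m t = t"
proof -
  define T where "T t = max 0 (min ((t - u) / (r - u)) ((v - t) / (v - r)))" for t
  define m where "m t = t + (r' - r) * T t" for t
  have outside: "m t = t" if "t \<notin> {u<..<v}" for t
  proof -
    have "(t - u) / (r - u) \<le> 0 \<or> (v - t) / (v - r) \<le> 0"
      using that assms by (auto simp: divide_le_0_iff)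
    then have "T t = 0" unfolding T_def by (simp add: min_le_iff_disj)
    then show ?thesis by (simp add: m_def)
  qed
  have mono: "m x < m y" if "x < y" for x y
  proof -
    have 1: "(y - u) / (r - u) = (x - u) / (r - u) + (y - x) / (r - u)"
      "(v - y) / (v - r) = (v - x) / (v - r) - (y - x) / (v - r)"
      by (simp_all add: diff_divide_distrib add_divide_distrib)
    have 2: "(y - x) / (r - u) > 0" "(y - x) / (v - r) > 0" using that assms by auto
    have 3: "T y - T x \<le> (y - x) / (r - u)" "T x - T y \<le> (y - x) / (v - r)"
      unfolding T_def 1 using 2 by linarith+
    show ?thesis
    proof (cases "r' \<ge> r")
      case True
      have "(r' - r) * (T x - T y) \<le> (r' - r) * ((y - x) / (v - r))"
        using True 3 by (intro mult_left_mono) auto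
      also have "\<dots> < (v - r) * ((y - x) / (v - r))"
        using assms 2 by (intro mult_strict_right_mono) auto
      also have "\<dots> = y - x" using assms by simp
      finally show ?thesis unfolding m_def by (simp add: algebra_simps)
    next
      case False
      have "(r - r') * (T y - T x) \<le> (r - r') * ((y - x) / (r - u))"
        using False 3 by (intro mult_left_mono) auto
      also have "\<dots> < (r - u) * ((y - x) / (r - u))"
        using assms 2 by (intro mult_strict_right_mono) auto
      also have "\<dots> = y - x" using assms by simp
      finally show ?thesis unfolding m_def by (simp add: algebra_simps)
    qed
  qed
  have cont: "continuous_on {u..v} m"
    unfolding m_def T_def using assms by (intro continuous_intros) auto
  have "\<exists>t. m t = y" for y
  proof (cases "y \<in> {u..v}")
    case True
    then have "\<exists>x\<ge>u. x \<le> v \<and> m x = y"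
      using outside[of u] outside[of v] assms by (intro IVT' cont) auto
    then show ?thesis by auto
  next
    case False
    then show ?thesis by (intro exI[of _ y] outside) auto
  qed
  then have "surj m" unfolding surj_def by metis
  moreover have "m r = r'" using assms by (simp add: m_def T_def)
  ultimately show ?thesis using mono outside by (intro that[of m]) (auto intro: strict_monoI)
qed

text \<open>A nonzero \<open>a\<close> without roots in the gap has constant sign there, and so has
  \<open>b\<close> on the image of the gap. Moving points inside that image is therefore invisible
  to the pair.\<close>

lemma same_signs_compose_gap:
  assumes h: "strict_mono h" "surj h" and ab: "same_signs h a b"
    and gap: "a = 0 \<or> (\<forall>z\<in>{t1<..<t2}. poly a z \<noteq> 0)"
    and m: "strict_mono m" "\<And>t. t \<notin> {h t1<..<h t2} \<Longrightarrow> m t = t"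
  shows "same_signs (m \<circ> h) a b"
  unfolding same_signs_def
proof
  fix t
  show "sgn (poly a t) = sgn (poly b ((m \<circ> h) t))"
  proof (cases "t \<in> {t1<..<t2}")
    case False
    then have "h t \<notin> {h t1<..<h t2}" using strict_mono_less[OF h(1)] by auto
    then show ?thesis using m ab by (simp add: same_signs_def)
  next
    case True
    then have ht: "h t \<in> {h t1<..<h t2}" using strict_mono_less[OF h(1)] by auto
    have "m (h t1) = h t1" "m (h t2) = h t2" using m by auto
    then have mht: "m (h t) \<in> {h t1<..<h t2}"
      using ht strict_mono_less[OF m(1), of "h t1" "h t"] strict_mono_less[OF m(1), of "h t" "h t2"]
      by auto
    show ?thesis
    proof (cases "a = 0")
      case True
      have "poly b y = 0" for y
        using ab True h(2) unfolding same_signs_def surj_def by (metis poly_0 sgn_0 sgn_0_0)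
      then show ?thesis using True by simp
    next
      case False
      have "poly b y \<noteq> 0" if "y \<in> {h t1<..<h t2}" for y
      proof -
        obtain z where z: "y = h z" using h(2) by auto
        then have "z \<in> {t1<..<t2}" using that strict_mono_less[OF h(1)] by auto
        then show ?thesis using gap False ab z unfolding same_signs_def by (metis sgn_0_0)
      qed
      then have "sgn (poly b (h t)) = sgn (poly b (m (h t)))"
        using ht mht by (intro sgn_poly_const) auto
      then show ?thesis using ab by (simp add: same_signs_def)
    qed
  qed
qed

lemma same_signs_0_iff:
  assumes "surj h" "same_signs h a b"
  shows "a = 0 \<longleftrightarrow> b = 0"
proof -
  have "(\<forall>t. poly a t = 0) \<longleftrightarrow> (\<forall>t. poly b t = 0)"
    using assms unfolding same_signs_def surj_def by (metis sgn_0_0)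
  then show ?thesis by (simp add: poly_all_0_iff_0)
qed

lemma finite_roots_family:
  assumes "finite G"
  shows "finite {t. \<exists>(a, b)\<in>G. a \<noteq> 0 \<and> poly (a :: real poly) t = 0}"
proof -
  have "{t. \<exists>(a, b)\<in>G. a \<noteq> 0 \<and> poly a t = 0} = (\<Union>(a, b)\<in>{(a, b)\<in>G. a \<noteq> 0}. {t. poly a t = 0})"
    by auto
  also have "finite \<dots>"
    using assms by (intro finite_UN_I) (auto intro: finite_subset[OF _ assms] poly_roots_finite)
  finally show ?thesis .
qed

text \<open>The nodes \<open>N\<close> cut the line into gaps on which \<open>p\<close> is strictly
  monotone and no nonzero first component in \<open>G\<close> vanishes. A root of \<open>p\<close>
  that \<open>h\<close> sends to a non-root of \<open>q\<close> is corrected by changing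
  \<open>h\<close> inside one gap only. Once all roots of \<open>p\<close> go to roots of
  \<open>q\<close>, monotonicity and the signs at the nodes settle all other points.\<close>

lemma same_signs_repair:
  fixes p q :: "real poly"
  assumes G: "finite G" "(pderiv p, pderiv q) \<in> G" "pderiv p \<noteq> 0"
    and N_def: "N = {t. \<exists>(a, b)\<in>G. a \<noteq> 0 \<and> poly a t = 0} \<union> {a0, a1}"
    and h: "strict_mono h" "surj h" "\<forall>(a, b)\<in>G. same_signs h a b"
    and nodes: "\<forall>t\<in>N. sgn (poly p t) = sgn (poly q (h t))"
    and out: "\<forall>t. t \<notin> {a0<..<a1} \<longrightarrow> sgn (poly p t) = sgn (poly q (h t))"
  shows "\<exists>h'. strict_mono h' \<and> surj h' \<and> (\<forall>(a, b)\<in>insert (p, q) G. same_signs h' a b)"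
  using h nodes out
\<comment> \<open>The measure counts the roots of \<open>p\<close> still sent to non-roots of
  \<open>q\<close>. The nodes stay fixed while \<open>h\<close> varies.\<close>
proof (induction "card {r. poly p r = 0 \<and> poly q (h r) \<noteq> 0}" arbitrary: h rule: less_induct)
  case less
  note h = less.prems(1,2) and hG = less.prems(3) and nodes = less.prems(4) and out = less.prems(5)
  have finN: "finite N" unfolding N_def using finite_roots_family[OF G(1)] by simp
  have fin: "finite {r. poly p r = 0}" using G(3) by (intro poly_roots_finite) auto
  have noroot: "\<forall>z\<in>{t1<..<t2}. poly a z \<noteq> 0"
    if "{t1<..<t2} \<inter> N = {}" "(a, b) \<in> G" "a \<noteq> 0" for t1 t2 a b
    using that unfolding N_def by force
  have slope: "sgn (poly (pderiv p) z) = sgn (poly (pderiv p) t)"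
    if "{t1<..<t2} \<inter> N = {}" "t \<in> {t1<..<t2}" "z \<in> {t1<..<t2}" for t1 t2 t z
    using noroot[OF that(1) G(2,3)] that by (intro sgn_poly_const) auto
  have slope': "sgn (poly (pderiv q) y) = sgn (poly (pderiv p) t)"
    if "{t1<..<t2} \<inter> N = {}" "t \<in> {t1<..<t2}" "y \<in> {h t1<..<h t2}" for t1 t2 t y
  proof -
    obtain z where z: "y = h z" using h(2) by auto
    then have "z \<in> {t1<..<t2}" using that strict_mono_less[OF h(1)] by auto
    then have "sgn (poly (pderiv p) z) = sgn (poly (pderiv p) t)" using that slope by blast
    then show ?thesis using hG G(2) z unfolding same_signs_def by auto
  qed
  have s: "sgn (poly (pderiv p) t) = 1 \<or> sgn (poly (pderiv p) t) = -1"
    if "{t1<..<t2} \<inter> N = {}" "t \<in> {t1<..<t2}" for t1 t2 t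
    using noroot[OF that(1) G(2,3)] that(2) by (auto simp: sgn_if)
  have gap: "\<exists>t1\<in>N. \<exists>t2\<in>N. t1 < t \<and> t < t2 \<and> {t1<..<t2} \<inter> N = {}" if "t \<in> {a0<..<a1}" "t \<notin> N" for t
  proof -
    have "a0 \<in> N" "a1 \<in> N" by (auto simp: N_def)
    then show ?thesis using finite_gap[OF finN that(2), of a0 a1] that(1) by (metis greaterThanLessThan_iff)
  qed
  show ?case
  proof (cases "\<exists>r. poly p r = 0 \<and> poly q (h r) \<noteq> 0")
    case False
    then have noroots: "poly p r = 0 \<Longrightarrow> poly q (h r) = 0" for r by blast
    have "same_signs h p q"
      unfolding same_signs_def
    proof
      fix t
      show "sgn (poly p t) = sgn (poly q (h t))"
      proof (cases "t \<in> N \<or> t \<notin> {a0<..<a1}")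
        case True
        then show ?thesis using nodes out by blast
      next
        case False
        then obtain t1 t2 where t: "t1 \<in> N" "t2 \<in> N" "t1 < t" "t < t2" "{t1<..<t2} \<inter> N = {}"
          using gap by blast
        then have I: "t \<in> {t1<..<t2}" by simp
        show ?thesis
        proof (rule sgn_agree_gap[OF h(1) t(3,4) _ _ s[OF t(5) I]])
          show "sgn (poly p t1) = sgn (poly q (h t1))" "sgn (poly p t2) = sgn (poly q (h t2))"
            using nodes t by blast+
        qed (use slope[OF t(5) I] slope'[OF t(5) I] noroots in blast)+
      qed
    qed
    then show ?thesis using h hG by auto
  next
    case True
    then obtain r where r: "poly p r = 0" "poly q (h r) \<noteq> 0" by auto
    then have "sgn (poly p r) \<noteq> sgn (poly q (h r))" by (simp add: sgn_0_0)
    then have "r \<notin> N" "r \<in> {a0<..<a1}" using nodes out by blast+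
    then obtain t1 t2 where t: "t1 \<in> N" "t2 \<in> N" "t1 < r" "r < t2" "{t1<..<t2} \<inter> N = {}"
      using gap by blast
    then have I: "r \<in> {t1<..<t2}" by simp
    define \<sigma> where "\<sigma> = sgn (poly (pderiv p) r)"
    have \<sigma>: "\<sigma> = 1 \<or> \<sigma> = -1" using s[OF t(5) I] by (simp add: \<sigma>_def)
    have P: "sgn (poly p z) = \<sigma> * sgn (z - r)" if "z \<in> {t1..t2}" for z
    proof -
      have "sgn (poly p z - poly p r) = \<sigma> * sgn (z - r)"
      proof (rule sgn_diff_root_in_gap[of r t1 t2])
        show "sgn (poly (pderiv p) y) = \<sigma>" if "y \<in> {t1<..<t2}" for y
          unfolding \<sigma>_def by (rule slope[OF t(5) I that])
      qed (use t that in auto)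
      then show ?thesis using r by simp
    qed
    \<comment> \<open>The root \<open>r\<close> of the monotone \<open>p\<close> forces opposite
      signs at the ends of the gap. The nodes transfer these signs to \<open>q\<close>, so the
      intermediate value theorem yields the target root \<open>r'\<close>.\<close>
    have "sgn (poly q (h t1)) = - \<sigma>" "sgn (poly q (h t2)) = \<sigma>"
      using P[of t1] P[of t2] t nodes by auto
    then have "poly q (h t1) * poly q (h t2) < 0"
      using \<sigma> by (auto simp: sgn_if mult_less_0_iff split: if_splits)
    moreover have ht: "h t1 < h r" "h r < h t2" using t strict_mono_less[OF h(1)] by auto
    ultimately obtain r' where r': "h t1 < r'" "r' < h t2" "poly q r' = 0"
      using poly_IVT[of "h t1" "h t2"] by auto
    obtain m where m: "strict_mono m" "surj m" "m (h r) = r'"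
      "\<And>t. t \<notin> {h t1<..<h t2} \<Longrightarrow> m t = t"
      using reparam_gap[OF ht r'(1,2)] by metis
    have same: "(m \<circ> h) z = h z" if "z \<notin> {t1<..<t2}" for z
      using that strict_mono_less[OF h(1)] by (auto intro!: m(4))
    show ?thesis
    proof (rule less.hyps[of "m \<circ> h"])
      have "{z. poly p z = 0 \<and> poly q ((m \<circ> h) z) \<noteq> 0} \<subset> {r. poly p r = 0 \<and> poly q (h r) \<noteq> 0}"
      proof (intro psubsetI)
        show "{z. poly p z = 0 \<and> poly q ((m \<circ> h) z) \<noteq> 0} \<noteq> {r. poly p r = 0 \<and> poly q (h r) \<noteq> 0}"
          using r r' m(3) by auto
        show "{z. poly p z = 0 \<and> poly q ((m \<circ> h) z) \<noteq> 0} \<subseteq> {r. poly p r = 0 \<and> poly q (h r) \<noteq> 0}"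
        proof (intro subsetI CollectI)
          fix z assume "z \<in> {z. poly p z = 0 \<and> poly q ((m \<circ> h) z) \<noteq> 0}"
          then have z: "poly p z = 0" "poly q (m (h z)) \<noteq> 0" by auto
          \<comment> \<open>The gap contains no root of \<open>p\<close> other than
            \<open>r\<close>, and \<open>r\<close> is now sent to \<open>r'\<close>. Outside the gap
            nothing has changed, so the repair creates no new bad root.\<close>
          have "z \<notin> {t1<..<t2}"
          proof
            assume "z \<in> {t1<..<t2}"
            then have "\<sigma> * sgn (z - r) = 0" using P[of z] z by auto
            then show False using \<sigma> z m(3) r'(3) by (auto simp: sgn_0_0)
          qed
          then show "poly p z = 0 \<and> poly q (h z) \<noteq> 0" using same z by auto
        qed
      qed
      then show "card {z. poly p z = 0 \<and> poly q ((m \<circ> h) z) \<noteq> 0} < card {r. poly p r = 0 \<and> poly q (h r) \<noteq> 0}"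
        by (intro psubset_card_mono) (auto intro: finite_subset[OF _ fin])
      show "strict_mono (m \<circ> h)" using m(1) h(1) by (auto simp: strict_mono_def)
      show "surj (m \<circ> h)" using m(2) h(2) by (rule comp_surj[rotated])
      show "\<forall>(a, b)\<in>G. same_signs (m \<circ> h) a b"
        using hG noroot[OF t(5)] same_signs_compose_gap[OF h _ _ m(1,4)] by fast
      show "\<forall>t\<in>N. sgn (poly p t) = sgn (poly q ((m \<circ> h) t))"
        using nodes same t(5) by (metis disjoint_iff)
      have "a0 \<le> t1" "t2 \<le> a1"
      proof -
        have "a0 \<in> N" "a1 \<in> N" by (auto simp: N_def)
        then have "a0 \<notin> {t1<..<t2}" "a1 \<notin> {t1<..<t2}" using t(5) by auto
        then show "a0 \<le> t1" "t2 \<le> a1" using \<open>r \<in> {a0<..<a1}\<close> t by auto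
      qed
      then show "\<forall>t. t \<notin> {a0<..<a1} \<longrightarrow> sgn (poly p t) = sgn (poly q ((m \<circ> h) t))"
        using out same by (metis greaterThanLessThan_iff order_le_less_trans order_less_le_trans)
    qed
  qed
qed

lemma finite_strict_bounds:
  fixes R :: "real set"
  assumes "finite R"
  obtains a b where "a < b" "\<And>z. z \<in> R \<Longrightarrow> a < z \<and> z < b"
proof -
  obtain B where B: "\<forall>z\<in>R. norm z \<le> B" using finite_imp_bounded[OF assms] bounded_iff by blast
  show ?thesis by (rule that[of "- \<bar>B\<bar> - 1" "\<bar>B\<bar> + 1"]) (use B in force)+
qed

text \<open>At a root \<open>t\<close> of \<open>a\<close>, the value of \<open>p\<close> equals
  that of \<open>p mod a\<close>, so the remainders fix the sign of \<open>p\<close> at every node.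
  Beyond all roots the derivative fixes it. What is left, the behaviour inside bounded gaps, is
  handled by \<open>same_signs_repair\<close>. The constant coefficient decides the case
  \<open>pderiv p = 0\<close>.\<close>

lemma same_signs_extend:
  fixes p q :: "real poly"
  assumes h: "strict_mono h" "surj h" and G: "finite G" "(pderiv p, pderiv q) \<in> G"
    and same: "\<forall>(a, b)\<in>G. same_signs h a b"
    and const: "same_signs h [:coeff p 0:] [:coeff q 0:]"
    and rems: "\<forall>(a, b)\<in>G. a \<noteq> 0 \<longrightarrow> b \<noteq> 0 \<longrightarrow> same_signs h (p mod a) (q mod b)"
  shows "\<exists>h'. strict_mono h' \<and> surj h' \<and> (\<forall>(a, b)\<in>insert (p, q) G. same_signs h' a b)"
proof (cases "pderiv p = 0")
  case True
  then have "pderiv q = 0" using same_signs_0_iff[OF h(2), of "pderiv p" "pderiv q"] same G(2) by auto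
  then have "p = [:coeff p 0:]" "q = [:coeff q 0:]"
    using True by (auto simp: pderiv_eq_0_iff elim!: degree_eq_zeroE)
  then show ?thesis using const same h by (intro exI[of _ h]) auto
next
  case False
  then have q': "pderiv q \<noteq> 0" using same_signs_0_iff[OF h(2), of "pderiv p" "pderiv q"] same G(2) by auto
  have deg: "degree p > 0" "degree q > 0" using False q' by (auto simp: pderiv_eq_0_iff)
  define N0 where "N0 = {t. \<exists>(a, b)\<in>G. a \<noteq> 0 \<and> poly a t = 0}"
  \<comment> \<open>Including the preimage of the roots of \<open>q\<close> lets one pair
    \<open>a0\<close>, \<open>a1\<close> bound the roots on both sides of the comparison.\<close>
  define R where "R = N0 \<union> {t. poly p t = 0} \<union> h -` {t. poly q t = 0}"
  have "p \<noteq> 0" "q \<noteq> 0" using deg by auto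
  then have "finite R"
    unfolding R_def N0_def
    by (intro finite_UnI finite_vimageI poly_roots_finite finite_roots_family[OF G(1)]
        strict_mono_imp_inj_on[OF h(1)])
  then obtain a0 a1 where a: "a0 < a1" "\<And>z. z \<in> R \<Longrightarrow> a0 < z \<and> z < a1"
    using finite_strict_bounds by metis
  have nz: "poly p z \<noteq> 0" "poly (pderiv p) z \<noteq> 0" "poly q (h z) \<noteq> 0" "poly (pderiv q) (h z) \<noteq> 0"
    if "z \<notin> {a0<..<a1}" for z
  proof -
    have z: "z \<notin> R" using a(2)[of z] that by auto
    then show "poly p z \<noteq> 0" "poly q (h z) \<noteq> 0" by (auto simp: R_def)
    show *: "poly (pderiv p) z \<noteq> 0" using z False G(2) unfolding R_def N0_def by blast
    then show "poly (pderiv q) (h z) \<noteq> 0" using same G(2) unfolding same_signs_def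
      by (metis (mono_tags, lifting) case_prodD sgn_0_0)
  qed
  have eq': "sgn (poly (pderiv p) t) = sgn (poly (pderiv q) (h t))" for t
    using same G(2) unfolding same_signs_def by auto
  have below: "sgn (poly p t) = sgn (poly q (h t))" if "t \<le> a0" for t
  proof -
    have "poly q z \<noteq> 0 \<and> poly (pderiv q) z \<noteq> 0" if "z \<le> h t" for z
    proof -
      obtain w where "z = h w" using h(2) by auto
      then show ?thesis using nz[of w] that \<open>t \<le> a0\<close> strict_mono_less_eq[OF h(1), of w t] by auto
    qed
    then have "sgn (poly q (h t)) = - sgn (poly (pderiv q) (h t))"
      using deg by (intro sgn_poly_below_roots) auto
    moreover have "sgn (poly p t) = - sgn (poly (pderiv p) t)"
      using deg nz that by (intro sgn_poly_below_roots) auto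
    ultimately show ?thesis using eq' by simp
  qed
  have above: "sgn (poly p t) = sgn (poly q (h t))" if "t \<ge> a1" for t
  proof -
    have "poly q z \<noteq> 0 \<and> poly (pderiv q) z \<noteq> 0" if "z \<ge> h t" for z
    proof -
      obtain w where "z = h w" using h(2) by auto
      then show ?thesis using nz[of w] that \<open>t \<ge> a1\<close> strict_mono_less_eq[OF h(1), of t w] by auto
    qed
    then have "sgn (poly q (h t)) = sgn (poly (pderiv q) (h t))"
      using deg by (intro sgn_poly_above_roots) auto
    moreover have "sgn (poly p t) = sgn (poly (pderiv p) t)"
      using deg nz that by (intro sgn_poly_above_roots) auto
    ultimately show ?thesis using eq' by simp
  qed
  have node: "sgn (poly p t) = sgn (poly q (h t))" if "t \<in> N0" for t
  proof -
    obtain a b where ab: "(a, b) \<in> G" "a \<noteq> 0" "poly a t = 0" using \<open>t \<in> N0\<close> by (auto simp: N0_def)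
    then have "same_signs h a b" using same by auto
    then have "b \<noteq> 0" "poly b (h t) = 0"
      using ab same_signs_0_iff[OF h(2)] unfolding same_signs_def by (blast, metis sgn_0_0)
    then have "sgn (poly (p mod a) t) = sgn (poly (q mod b) (h t))"
      using rems ab unfolding same_signs_def by auto
    moreover have "poly p t = poly (p mod a) t"
      using ab div_mult_mod_eq[of p a] by (metis add_0 mult_zero_right poly_add poly_mult)
    moreover have "poly q (h t) = poly (q mod b) (h t)"
      using \<open>poly b (h t) = 0\<close> div_mult_mod_eq[of q b] by (metis add_0 mult_zero_right poly_add poly_mult)
    ultimately show ?thesis by simp
  qed
  show ?thesis
    by (rule same_signs_repair[OF G False refl h same, of a0 a1])
      (use node below above in \<open>auto simp: N0_def not_less\<close>)
qed

section \<open>Division with remainder, uniformly in the parameter\<close>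

lemma pw_poly_sum:
  "finite I \<Longrightarrow> (\<And>i. i \<in> I \<Longrightarrow> pw_poly d (P i)) \<Longrightarrow> pw_poly d (\<lambda>x. \<Sum>i\<in>I. P i x)"
proof (induction I rule: finite_induct)
  case empty
  show ?case using pw_poly_mono[OF pw_poly_const[OF pw_rational_const[of 0]], of d] by simp
next
  case (insert i I)
  then show ?case using pw_poly_add[of d "P i" d] by simp
qed

lemma degree_diff_leading_monom:
  fixes p q :: "real poly"
  assumes "degree p = Suc d" "q \<noteq> 0" "degree q \<le> Suc d"
  shows "degree (p - monom (coeff p (Suc d) / lead_coeff q) (Suc d - degree q) * q) \<le> d"
proof (rule degree_le, intro allI impI)
  fix i assume "d < i"
  then consider "i = Suc d" | "i > Suc d" by linarith
  then show "coeff (p - monom (coeff p (Suc d) / lead_coeff q) (Suc d - degree q) * q) i = 0"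
  proof cases
    case 1
    then show ?thesis using assms by (simp add: coeff_monom_mult)
  next
    case 2
    then have "coeff p i = 0" "coeff q (i - (Suc d - degree q)) = 0"
      using assms by (auto intro!: coeff_eq_0)
    then show ?thesis by (simp add: coeff_monom_mult)
  qed
qed

text \<open>Long division by induction on the degree bound of \<open>P\<close>: each step cancels
  the leading term, or stops if \<open>Q\<close> is zero or has too large a degree.\<close>

lemma pw_poly_mod:
  assumes Q: "pw_poly e Q"
  shows "pw_poly d P \<Longrightarrow> pw_poly d (\<lambda>x. P x mod Q x)"
proof (induction d arbitrary: P)
  case 0
  have "P x mod Q x = (if degree (Q x) = 0 \<and> Q x \<noteq> 0 then 0 else P x)" for x
  proof -
    have "degree (P x) = 0" using 0 by (simp add: pw_poly_def)
    then show ?thesis using mod_poly_less[of "P x" "Q x"] degree_mod_less[of "Q x" "P x"] by auto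
  qed
  moreover have "pw_poly 0 (\<lambda>x. if degree (Q x) = 0 \<and> Q x \<noteq> 0 then 0 else P x)"
    using 0 pw_poly_const[OF pw_rational_const[of 0]]
    by (intro pw_poly_if semialgebraic_Collect_conj semialgebraic_Collect_not
        semialgebraic_degree_eq[OF Q] semialgebraic_poly_eq_0[OF Q]) auto
  ultimately show ?case by presburger
next
  case (Suc d)
  \<comment> \<open>The degree of \<open>Q x\<close> depends on \<open>x\<close>. Summing over its
    possible values \<open>k\<close>, with at most one nonzero summand, gives every summand a fixed
    exponent and coefficient index.\<close>
  define red where "red x = (\<Sum>k\<le>min e (Suc d). if degree (Q x) = k
     then P x - monom (coeff (P x) (Suc d) / coeff (Q x) k) (Suc d - k) * Q x else 0)" for x
  define high where "high x \<longleftrightarrow> degree (P x) = Suc d" for x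
  define small where "small x \<longleftrightarrow> \<not> degree (Q x) \<le> Suc d \<or> Q x = 0" for x
  have "semialgebraic {x. \<not> degree (Q x) \<le> Suc d \<or> Q x = 0}"
    by (rule semialgebraic_Collect_disj[OF semialgebraic_Collect_not[OF semialgebraic_degree_le[OF Q]]
        semialgebraic_poly_eq_0[OF Q]])
  then have sa: "semialgebraic {x. high x}" "semialgebraic {x. small x}"
    unfolding high_def small_def using semialgebraic_degree_eq[OF Suc.prems] by auto
  have zero: "pw_poly D (\<lambda>x. 0)" for D
    using pw_poly_mono[OF pw_poly_const[OF pw_rational_const[of 0]], of D] by simp
  have pwP: "pw_rational (\<lambda>x. coeff (P x) i)" and pwQ: "pw_rational (\<lambda>x. coeff (Q x) i)" for i
    using Suc.prems Q by (auto simp: pw_poly_def)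
  \<comment> \<open>A crude bound valid for the unreduced summands; the sharp bound \<open>d\<close>
    is recovered afterwards from the pointwise degree of \<open>P1\<close>.\<close>
  define D where "D = Suc d + e"
  have pw_red: "pw_poly D red"
    unfolding red_def
  proof (intro pw_poly_sum pw_poly_if semialgebraic_degree_eq[OF Q] zero)
    fix k assume k: "k \<in> {..min e (Suc d)}"
    have "pw_poly (max (Suc d) ((Suc d - k) + e))
       (\<lambda>x. P x - monom (coeff (P x) (Suc d) / coeff (Q x) k) (Suc d - k) * Q x)"
      by (intro pw_poly_diff pw_poly_mult pw_poly_monom pw_rational_divide pwP pwQ Q Suc.prems)
    then show "pw_poly D (\<lambda>x. P x - monom (coeff (P x) (Suc d) / coeff (Q x) k) (Suc d - k) * Q x)"
      by (rule pw_poly_mono) (auto simp: D_def)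
  qed simp
  have red: "red x = P x - monom (coeff (P x) (Suc d) / lead_coeff (Q x)) (Suc d - degree (Q x)) * Q x"
    if "\<not> small x" for x
  proof -
    have "degree (Q x) \<in> {..min e (Suc d)}" using that Q by (auto simp: small_def pw_poly_def)
    then show ?thesis unfolding red_def by (simp add: sum.delta)
  qed
  \<comment> \<open>The value 0 in the case \<open>high x\<close> and \<open>small x\<close> is a
    placeholder that keeps the degree at most \<open>d\<close>. There the remainder is
    \<open>P x\<close> itself, restored at the end.\<close>
  define P1 where "P1 x = (if high x then if small x then 0 else red x else P x)" for x
  have "pw_poly D P1"
    unfolding P1_def using sa Suc.prems
    by (intro pw_poly_if zero pw_red) (auto simp: D_def elim: pw_poly_mono)
  moreover have "degree (P1 x) \<le> d" for x
  proof -
    have "degree (P x) \<le> Suc d" using Suc.prems by (simp add: pw_poly_def)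
    moreover have "degree (red x) \<le> d" if "high x" "\<not> small x"
      unfolding red[OF that(2)] using that
      by (intro degree_diff_leading_monom) (auto simp: high_def small_def)
    ultimately show ?thesis by (auto simp: P1_def high_def)
  qed
  ultimately have "pw_poly d P1" by (rule pw_poly_degree_pred)
  then have "pw_poly d (\<lambda>x. P1 x mod Q x)" by (rule Suc.IH)
  then have "pw_poly (Suc d) (\<lambda>x. P1 x mod Q x)" by (rule pw_poly_mono) simp
  then have "pw_poly (Suc d) (\<lambda>x. if high x \<and> small x then P x else P1 x mod Q x)"
    using sa Suc.prems by (intro pw_poly_if semialgebraic_Collect_conj)
  moreover have "P x mod Q x = (if high x \<and> small x then P x else P1 x mod Q x)" for x
  proof (cases "high x")
    case True
    show ?thesis
    proof (cases "small x")
      case True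
      then have "P x mod Q x = P x"
        using \<open>high x\<close> by (auto simp: small_def high_def intro: mod_poly_less)
      then show ?thesis using True \<open>high x\<close> by simp
    next
      case False
      then show ?thesis using \<open>high x\<close> by (simp add: P1_def red poly_mod_diff_left)
    qed
  qed (simp add: P1_def)
  ultimately show ?case by presburger
qed

text \<open>Since \<open>P mod 0 = P\<close>, the remainder would have uncontrolled degree where
  \<open>Q\<close> vanishes. Setting it to 0 there makes the degree drop strictly below the bound
  for \<open>Q\<close> everywhere, which drives the induction on degrees.\<close>

lemma pw_poly_mod_or_0:
  assumes P: "pw_poly d P" and Q: "pw_poly (Suc e) Q"
  shows "pw_poly e (\<lambda>x. if Q x = 0 then 0 else P x mod Q x)"
proof (rule pw_poly_degree_pred)
  show "pw_poly d (\<lambda>x. if Q x = 0 then 0 else P x mod Q x)"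
    using pw_poly_mono[OF pw_poly_const[OF pw_rational_const[of 0]], of d]
    by (intro pw_poly_if semialgebraic_poly_eq_0[OF Q] pw_poly_mod[OF Q P]) simp
  show "degree (if Q x = 0 then 0 else P x mod Q x) \<le> e" for x
    using degree_mod_less[of "Q x" "P x"] Q unfolding pw_poly_def
    by (auto simp: less_Suc_eq_le dest!: spec[of _ x])
qed

section \<open>Finitely many sign diagrams on semialgebraic pieces\<close>

text \<open>One bijection \<open>h\<close> for all members at once: the relative position of roots
  of different members is part of the diagram.\<close>

definition sign_equiv :: "('a \<Rightarrow> real poly) set \<Rightarrow> 'a \<Rightarrow> 'a \<Rightarrow> bool" where
  "sign_equiv F x y \<longleftrightarrow> (\<exists>h. strict_mono h \<and> surj h \<and> (\<forall>P\<in>F. same_signs h (P x) (P y)))"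

definition tame :: "('a::euclidean_space \<Rightarrow> real poly) set \<Rightarrow> bool" where
  "tame F \<longleftrightarrow> piecewise (\<lambda>S. \<forall>x\<in>S. \<forall>y\<in>S. sign_equiv F x y)"

lemma tame_mono: "tame F \<Longrightarrow> (\<And>x y. sign_equiv F x y \<Longrightarrow> sign_equiv G x y) \<Longrightarrow> tame G"
  unfolding tame_def by (erule piecewise_mono) blast

lemma piecewise_sgn:
  assumes "pw_rational f"
  shows "piecewise (\<lambda>S. \<forall>x\<in>S. \<forall>y\<in>S. sgn (f x) = sgn (f y))"
proof (rule piecewise_combine[OF piecewise_split[OF semialgebraic_pw_pos[OF assms]]
        piecewise_split[OF semialgebraic_pw_eq_0[OF assms]]])
  fix S T assume "S \<subseteq> {x. 0 < f x} \<or> S \<subseteq> - {x. 0 < f x}" "T \<subseteq> {x. f x = 0} \<or> T \<subseteq> - {x. f x = 0}"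
  then have "\<forall>x\<in>S \<inter> T. \<forall>y\<in>S \<inter> T. (0 < f x \<longleftrightarrow> 0 < f y) \<and> (f x = 0 \<longleftrightarrow> f y = 0)" by fast
  then show "\<forall>x\<in>S \<inter> T. \<forall>y\<in>S \<inter> T. sgn (f x) = sgn (f y)" by (metis sgn_if)
qed

lemma tame_constant:
  assumes "finite F" "\<And>P. P \<in> F \<Longrightarrow> pw_poly 0 P"
  shows "tame F"
proof -
  have "piecewise (\<lambda>S. \<forall>x\<in>S. \<forall>y\<in>S. \<forall>P\<in>F. sgn (coeff (P x) 0) = sgn (coeff (P y) 0))"
    using assms
  proof (induction F rule: finite_induct)
    case empty
    show ?case by (rule piecewise_trivial) simp
  next
    case (insert P F)
    have "pw_rational (\<lambda>x. coeff (P x) 0)" using insert.prems by (auto simp: pw_poly_def)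
    from piecewise_sgn[OF this] insert.IH show ?case
      by (rule piecewise_combine) (use insert.prems in auto)
  qed
  then show ?thesis
    unfolding tame_def
  proof (rule piecewise_mono)
    fix S assume *: "\<forall>x\<in>S. \<forall>y\<in>S. \<forall>P\<in>F. sgn (coeff (P x) 0) = sgn (coeff (P y) 0)"
    have c: "poly (P x) t = coeff (P x) 0" if "P \<in> F" for P x t
    proof -
      have "degree (P x) = 0" using assms(2)[OF that] unfolding pw_poly_def by simp
      then obtain c where "P x = [:c:]" by (rule degree_eq_zeroE)
      then show ?thesis by simp
    qed
    then show "\<forall>x\<in>S. \<forall>y\<in>S. sign_equiv F x y"
    proof (intro ballI)
      fix x y assume "x \<in> S" "y \<in> S"
      then have "\<forall>P\<in>F. same_signs id (P x) (P y)"
        using * c unfolding same_signs_def id_def by metis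
      then show "sign_equiv F x y"
        unfolding sign_equiv_def by (intro exI[of _ id]) (simp add: strict_mono_def)
    qed
  qed
qed

text \<open>The family assumed tame need not contain \<open>P\<close>. Its diagram supplies the
  bijection that \<open>same_signs_extend\<close> turns into one for \<open>P\<close> as
  well.\<close>

lemma tame_step:
  assumes F: "finite F" and
    t: "tame (insert (\<lambda>x. pderiv (P x)) F \<union> {\<lambda>x. [:coeff (P x) 0:]} \<union>
       (\<lambda>Q x. if Q x = 0 then 0 else P x mod Q x) ` insert (\<lambda>x. pderiv (P x)) F)"
  shows "tame (insert P F)"
  using t
proof (rule tame_mono)
  fix x y
  let ?F = "insert (\<lambda>x. pderiv (P x)) F"
  assume "sign_equiv (?F \<union> {\<lambda>x. [:coeff (P x) 0:]} \<union>
       (\<lambda>Q x. if Q x = 0 then 0 else P x mod Q x) ` ?F) x y"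
  then obtain h where h: "strict_mono h" "surj h"
    and *: "\<forall>R\<in>?F \<union> {\<lambda>x. [:coeff (P x) 0:]} \<union> (\<lambda>Q x. if Q x = 0 then 0 else P x mod Q x) ` ?F.
       same_signs h (R x) (R y)"
    unfolding sign_equiv_def by blast
  let ?G = "(\<lambda>R. (R x, R y)) ` ?F"
  have "\<exists>h'. strict_mono h' \<and> surj h' \<and> (\<forall>(a, b)\<in>insert (P x, P y) ?G. same_signs h' a b)"
  proof (rule same_signs_extend[OF h])
    show "finite ?G" using F by simp
    show "(pderiv (P x), pderiv (P y)) \<in> ?G" by auto
    show "\<forall>(a, b)\<in>?G. same_signs h a b" using * by auto
    show "same_signs h [:coeff (P x) 0:] [:coeff (P y) 0:]" using * by auto
    have "same_signs h (P x mod Q x) (P y mod Q y)" if "Q \<in> ?F" "Q x \<noteq> 0" "Q y \<noteq> 0" for Q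
    proof -
      have "(\<lambda>x. if Q x = 0 then 0 else P x mod Q x) \<in> (\<lambda>Q x. if Q x = 0 then 0 else P x mod Q x) ` ?F"
        using that(1) by (rule imageI)
      from *[rule_format, OF UnI2[OF this]] show ?thesis using that by simp
    qed
    then show "\<forall>(a, b)\<in>?G. a \<noteq> 0 \<longrightarrow> b \<noteq> 0 \<longrightarrow> same_signs h (P x mod a) (P y mod b)" by auto
  qed
  then show "sign_equiv (insert P F) x y" unfolding sign_equiv_def by auto
qed

theorem tame_family:
  assumes "finite F" "\<And>P. P \<in> F \<Longrightarrow> pw_poly d P"
  shows "tame F"
  using assms
proof (induction d arbitrary: F)
  case 0
  then show ?case by (rule tame_constant)
next
  case (Suc d)
  \<comment> \<open>\<open>B\<close> holds the polynomials of bound \<open>Suc d\<close> still to be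
    removed, \<open>C\<close> those of bound \<open>d\<close>. Removing one \<open>P\<close> from
    \<open>B\<close> adds its derivative, constant term and remainders, all of bound
    \<open>d\<close>. So \<open>C\<close> grows but \<open>B\<close> shrinks, and for empty
    \<open>B\<close> the outer induction on the degree applies.\<close>
  have "tame (B \<union> C)" if "finite B" "\<And>P. P \<in> B \<Longrightarrow> pw_poly (Suc d) P"
    "finite C" "\<And>P. P \<in> C \<Longrightarrow> pw_poly d P" for B C :: "('a \<Rightarrow> real poly) set"
    using that
  proof (induction B arbitrary: C rule: finite_induct)
    case empty
    then show ?case using Suc.IH by simp
  next
    case (insert P B)
    have P: "pw_poly (Suc d) P" using insert.prems by auto
    let ?rem = "\<lambda>Q x. if Q x = 0 then 0 else P x mod Q x"
    let ?F = "insert (\<lambda>x. pderiv (P x)) (B \<union> C)"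
    have deg: "pw_poly (Suc d) Q" if "Q \<in> ?F" for Q
      using that insert.prems pw_poly_mono[OF pw_poly_pderiv[OF P], of "Suc d"]
      by (auto intro: pw_poly_mono[of d])
    have "tame (B \<union> (C \<union> {\<lambda>x. pderiv (P x)} \<union> {\<lambda>x. [:coeff (P x) 0:]} \<union> ?rem ` ?F))"
    proof (rule insert.IH)
      show "finite (C \<union> {\<lambda>x. pderiv (P x)} \<union> {\<lambda>x. [:coeff (P x) 0:]} \<union> ?rem ` ?F)"
        using insert by auto
      show "pw_poly (Suc d) R" if "R \<in> B" for R using insert.prems that by auto
      fix R assume "R \<in> C \<union> {\<lambda>x. pderiv (P x)} \<union> {\<lambda>x. [:coeff (P x) 0:]} \<union> ?rem ` ?F"
      moreover have "pw_poly d (\<lambda>x. [:coeff (P x) 0:])"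
        using P by (intro pw_poly_mono[OF pw_poly_const]) (auto simp: pw_poly_def)
      moreover have "pw_poly d (?rem Q)" if "Q \<in> ?F" for Q
        by (rule pw_poly_mod_or_0[OF P deg[OF that]])
      ultimately show "pw_poly d R"
        using insert.prems(3) pw_poly_pderiv[OF P] by blast
    qed
    moreover have "B \<union> (C \<union> {\<lambda>x. pderiv (P x)} \<union> {\<lambda>x. [:coeff (P x) 0:]} \<union> ?rem ` ?F)
      = ?F \<union> {\<lambda>x. [:coeff (P x) 0:]} \<union> ?rem ` ?F" by auto
    ultimately have "tame (insert P (B \<union> C))"
      using insert by (intro tame_step) auto
    then show ?case by simp
  qed
  from this[of F "{}"] show ?case using Suc.prems by simp
qed

section \<open>Eliminating one real quantifier\<close>

lemma pw_poly_of_polynomial: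
  fixes p :: "'a::euclidean_space \<times> real \<Rightarrow> real"
  assumes "real_polynomial_function p"
  shows "\<exists>d P. pw_poly d P \<and> (\<forall>x t. p (x, t) = poly (P x) t)"
  using assms
proof induction
  case (linear f)
  have "pw_poly (max 0 (0 + 1)) (\<lambda>x. [:f (x, 0):] + [:f (0, 1):] * monom 1 1)"
    using linear
    by (intro pw_poly_add pw_poly_mult pw_poly_const pw_poly_monom pw_rational_const pw_rational_poly
        real_polynomial_function.intros(1) bounded_linear_compose[OF linear])
      (intro bounded_linear_Pair bounded_linear_ident bounded_linear_zero)
  moreover have "f (x, t) = poly ([:f (x, 0):] + [:f (0, 1):] * monom 1 1) t" for x t
  proof -
    have "(x, t) = (x, 0) + t *\<^sub>R (0, 1)" by simp
    then have "f (x, t) = f (x, 0) + t *\<^sub>R f (0, 1)"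
      using linear by (metis bounded_linear.linear linear_add linear_scale)
    then show ?thesis by (simp add: poly_monom)
  qed
  ultimately show ?case by blast
next
  case (const c)
  have "pw_poly 0 (\<lambda>x::'a. [:c:])" by (intro pw_poly_const pw_rational_const)
  then show ?case by (intro exI[of _ 0] exI[of _ "\<lambda>x. [:c:]"]) auto
next
  case (add f g)
  then obtain d P e Q where "pw_poly d P" "\<forall>x t. f (x, t) = poly (P x) t"
    "pw_poly e Q" "\<forall>x t. g (x, t) = poly (Q x) t" by blast
  then show ?case using pw_poly_add[of d P e Q]
    by (intro exI[of _ "max d e"] exI[of _ "\<lambda>x. P x + Q x"]) auto
next
  case (mult f g)
  then obtain d P e Q where "pw_poly d P" "\<forall>x t. f (x, t) = poly (P x) t"
    "pw_poly e Q" "\<forall>x t. g (x, t) = poly (Q x) t" by blast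
  then show ?case using pw_poly_mult[of d P e Q]
    by (intro exI[of _ "d + e"] exI[of _ "\<lambda>x. P x * Q x"]) auto
qed

text \<open>Membership is compared across different parameters \<open>x\<close> and
  \<open>y\<close>, so that it can be transported along a bijection matching two sign
  diagrams.\<close>

definition sign_determined :: "('a \<Rightarrow> real poly) set \<Rightarrow> ('a \<times> real) set \<Rightarrow> bool" where
  "sign_determined F S \<longleftrightarrow> (\<forall>x y t u. (\<forall>P\<in>F. sgn (poly (P x) t) = sgn (poly (P y) u)) \<longrightarrow>
      ((x, t) \<in> S \<longleftrightarrow> (y, u) \<in> S))"

lemma sign_determined_Un:
  assumes "sign_determined F S" "sign_determined G T"
  shows "sign_determined (F \<union> G) (S \<union> T)" "sign_determined (F \<union> G) (S \<inter> T)"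
proof -
  have "((x, t) \<in> S \<longleftrightarrow> (y, u) \<in> S) \<and> ((x, t) \<in> T \<longleftrightarrow> (y, u) \<in> T)"
    if "\<forall>P\<in>F \<union> G. sgn (poly (P x) t) = sgn (poly (P y) u)" for x y t u
    using assms that unfolding sign_determined_def by simp
  then show "sign_determined (F \<union> G) (S \<union> T)" "sign_determined (F \<union> G) (S \<inter> T)"
    unfolding sign_determined_def Un_iff Int_iff by metis+
qed

lemma semialgebraic_sign_determined:
  fixes S :: "('a::euclidean_space \<times> real) set"
  assumes "semialgebraic S"
  shows "\<exists>d F. finite F \<and> (\<forall>P\<in>F. pw_poly d P) \<and> sign_determined F S"
  using assms
proof induction
  case (pos p)
  then obtain d P where P: "pw_poly d P" "\<forall>x t. p (x, t) = poly (P x) t"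
    using pw_poly_of_polynomial by blast
  have "0 < p (x, t) \<longleftrightarrow> sgn (poly (P x) t) = 1" for x t
    using P by (simp add: sgn_if)
  then have "sign_determined {P} {x. 0 < p x}" by (simp add: sign_determined_def)
  then show ?case using P by (intro exI[of _ d] exI[of _ "{P}"]) simp
next
  case (Un S T)
  then obtain d F e G where *: "finite F" "\<forall>P\<in>F. pw_poly d P" "sign_determined F S"
    "finite G" "\<forall>P\<in>G. pw_poly e P" "sign_determined G T" by blast
  then have "sign_determined (F \<union> G) (S \<union> T)" by (intro sign_determined_Un)
  moreover have "\<forall>P\<in>F \<union> G. pw_poly (max d e) P" using * by (auto intro: pw_poly_mono)
  ultimately show ?case using * by blast
next
  case (Int S T)
  then obtain d F e G where *: "finite F" "\<forall>P\<in>F. pw_poly d P" "sign_determined F S"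
    "finite G" "\<forall>P\<in>G. pw_poly e P" "sign_determined G T" by blast
  then have "sign_determined (F \<union> G) (S \<inter> T)" by (intro sign_determined_Un)
  moreover have "\<forall>P\<in>F \<union> G. pw_poly (max d e) P" using * by (auto intro: pw_poly_mono)
  ultimately show ?case using * by blast
next
  case (Compl S)
  then show ?case by (simp add: sign_determined_def)
qed

text \<open>On a piece with constant sign diagram either every parameter has a witness or none has,
  so the projection is a finite union of pieces.\<close>

theorem semialgebraic_projection_real:
  fixes S :: "('a::euclidean_space \<times> real) set"
  assumes "semialgebraic S"
  shows "semialgebraic {x. \<exists>t. (x, t) \<in> S}"
proof -
  obtain d F where F: "finite F" "\<forall>P\<in>F. pw_poly d P" "sign_determined F S"
    using semialgebraic_sign_determined[OF assms] by blast
  have "tame F" using tame_family F by blast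
  then show ?thesis
    unfolding tame_def
  proof (rule semialgebraic_piecewise)
    fix T assume T: "semialgebraic T" "\<forall>x\<in>T. \<forall>y\<in>T. sign_equiv F x y"
    have "\<exists>t. (y, t) \<in> S" if "x \<in> T" "y \<in> T" "(x, t) \<in> S" for x y t
    proof -
      obtain h where "\<forall>P\<in>F. same_signs h (P x) (P y)"
        using T(2) \<open>x \<in> T\<close> \<open>y \<in> T\<close> unfolding sign_equiv_def by blast
      \<comment> \<open>The bijection that matches the two diagrams carries the witness over
        \<open>x\<close> to one over \<open>y\<close>.\<close>
      then have "(y, h t) \<in> S"
        using F(3) \<open>(x, t) \<in> S\<close> unfolding sign_determined_def same_signs_def by blast
      then show ?thesis by blast
    qed
    then have "T \<inter> {x. \<exists>t. (x, t) \<in> S} = T \<or> T \<inter> {x. \<exists>t. (x, t) \<in> S} = {}" by blast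
    then show "semialgebraic (T \<inter> {x. \<exists>t. (x, t) \<in> S})" using T(1) by auto
  qed
qed

section \<open>Semialgebraic functions\<close>

lemma semialgebraic_vimage_polynomial:
  fixes f :: "'a::euclidean_space \<Rightarrow> 'b::euclidean_space"
  assumes f: "polynomial_function f" and S: "semialgebraic S"
  shows "semialgebraic (f -` S)"
  using S
proof induction
  case (pos p)
  have "f -` {x. p x > 0} = {x. (p \<circ> f) x > 0}" by auto
  then show ?case
    using semialgebraic.pos[OF real_polynomial_function_compose[OF f pos]] by simp
qed (auto simp: vimage_Compl intro: semialgebraic.intros)

lemma semialgebraic_vimage_linear:
  fixes f :: "'a::euclidean_space \<Rightarrow> 'b::euclidean_space"
  assumes "linear f" "semialgebraic S"
  shows "semialgebraic {x. f x \<in> S}"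
  using semialgebraic_vimage_polynomial[OF polynomial_function_bounded_linear, of f S] assms
  by (simp add: vimage_def linear_linear)

text \<open>Coordinates are eliminated one basis vector at a time. Quantifying over translations of
  \<open>snd z\<close> by \<open>span B\<close> keeps the ambient type fixed during the induction;
  at the end the translation is arbitrary, so the base point may be taken to be 0.\<close>

lemma semialgebraic_Ex:
  fixes P :: "'a::euclidean_space \<Rightarrow> 'b::euclidean_space \<Rightarrow> bool"
  assumes "semialgebraic {z. P (fst z) (snd z)}"
  shows "semialgebraic {x. \<exists>v. P x v}"
proof -
  have "finite B \<Longrightarrow> B \<subseteq> Basis \<Longrightarrow> semialgebraic {z. \<exists>u\<in>span B. P (fst z) (snd z + u)}" for B
  proof (induction B rule: finite_induct)
    case empty
    then show ?case using assms by simp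
  next
    case (insert b B)
    let ?S = "{z. \<exists>u\<in>span B. P (fst z) (snd z + u)}"
    let ?f = "\<lambda>w::('a \<times> 'b) \<times> real. (fst (fst w), snd (fst w) + snd w *\<^sub>R b)"
    have "linear ?f" by (auto intro!: linearI simp: algebra_simps)
    then have "semialgebraic {w. ?f w \<in> ?S}" using insert by (intro semialgebraic_vimage_linear) auto
    then have "semialgebraic {z. \<exists>t. (z, t) \<in> {w. ?f w \<in> ?S}}" by (rule semialgebraic_projection_real)
    moreover have "(\<exists>u\<in>span (insert b B). P x (v + u)) \<longleftrightarrow> (\<exists>t. \<exists>u\<in>span B. P x (v + t *\<^sub>R b + u))" for x v
    proof
      assume "\<exists>u\<in>span (insert b B). P x (v + u)"
      then obtain u k where u: "P x (v + u)" "u - k *\<^sub>R b \<in> span B" by (auto simp: span_insert)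
      then show "\<exists>t. \<exists>u\<in>span B. P x (v + t *\<^sub>R b + u)"
        by (intro exI[of _ k] bexI[of _ "u - k *\<^sub>R b"]) auto
    next
      assume "\<exists>t. \<exists>u\<in>span B. P x (v + t *\<^sub>R b + u)"
      then obtain t u where u: "P x (v + t *\<^sub>R b + u)" "u \<in> span B" by blast
      then have "P x (v + (t *\<^sub>R b + u))" by (simp add: add.assoc)
      moreover have "t *\<^sub>R b + u \<in> span (insert b B)"
      proof (rule span_add)
        show "t *\<^sub>R b \<in> span (insert b B)" by (intro span_mul span_base insertI1)
        show "u \<in> span (insert b B)" using u(2) span_mono[of B "insert b B"] by blast
      qed
      ultimately show "\<exists>u\<in>span (insert b B). P x (v + u)" by blast
    qed
    ultimately show ?case by simp
  qed
  from this[of Basis] have "semialgebraic {z. \<exists>u. P (fst z) (snd z + u)}" by simp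
  moreover have "(\<exists>u. P x (v + u)) \<longleftrightarrow> (\<exists>u. P x u)" for x v
  proof
    assume "\<exists>u. P x u"
    then obtain u where "P x (v + (u - v))" by auto
    then show "\<exists>u. P x (v + u)" by (rule exI)
  qed auto
  ultimately have "semialgebraic {z::'a \<times> 'b. \<exists>u. P (fst z) u}" by simp
  moreover have "linear (\<lambda>x::'a. (x, 0::'b))" by (auto intro!: linearI)
  ultimately show ?thesis
    using semialgebraic_vimage_linear[of "\<lambda>x::'a. (x, 0::'b)"] by force
qed

lemma semialgebraic_All:
  fixes P :: "'a::euclidean_space \<Rightarrow> 'b::euclidean_space \<Rightarrow> bool"
  assumes "semialgebraic {z. P (fst z) (snd z)}"
  shows "semialgebraic {x. \<forall>v. P x v}"
  using semialgebraic_Collect_not[OF semialgebraic_Ex[of "\<lambda>x v. \<not> P x v"]]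
    semialgebraic_Collect_not[OF assms] by simp

section \<open>A calculus of total semialgebraic functions and first-order formulas\<close>

abbreviation (input) sa :: "('a::euclidean_space \<Rightarrow> 'b::euclidean_space) \<Rightarrow> bool" where
  "sa \<equiv> semialgebraic_on UNIV"

lemma sa_def: "sa f \<longleftrightarrow> semialgebraic {z. snd z = f (fst z)}"
proof -
  have "{(x, f x) |x. x \<in> UNIV} = {z. snd z = f (fst z)}" by auto
  then show ?thesis by (simp add: semialgebraic_on_def)
qed

lemma semialgebraic_polynomial_eq_0:
  assumes "real_polynomial_function p"
  shows "semialgebraic {x. p x = 0}"
  using semialgebraic_pw_eq_0[OF pw_rational_poly[OF assms]] .

lemma semialgebraic_singleton_0: "semialgebraic {0 :: 'a::euclidean_space}"
proof -
  have "real_polynomial_function (\<lambda>y::'a. \<Sum>b\<in>Basis. (y \<bullet> b) * (y \<bullet> b))"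
    by (intro real_polynomial_function_sum finite_Basis real_polynomial_function.intros(4)
        real_polynomial_function.intros(1) bounded_linear_inner_left)
  from semialgebraic_polynomial_eq_0[OF this] show ?thesis
    by (simp flip: euclidean_inner)
qed

lemma sa_linear:
  fixes f :: "'a::euclidean_space \<Rightarrow> 'b::euclidean_space"
  assumes "linear f"
  shows "sa f"
proof -
  have "linear (\<lambda>z. snd z - f (fst z))"
    using assms by (auto intro!: linearI simp: linear_add linear_scale algebra_simps)
  then have "semialgebraic {z. snd z - f (fst z) \<in> {0}}"
    by (rule semialgebraic_vimage_linear[OF _ semialgebraic_singleton_0])
  then show ?thesis by (simp add: sa_def)
qed

lemma semialgebraic_vimage:
  assumes "sa f" "semialgebraic S"
  shows "semialgebraic {x. f x \<in> S}"
proof -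
  have "semialgebraic {z. snd z \<in> S}"
    using assms(2) by (intro semialgebraic_vimage_linear) (auto intro: linearI)
  then have "semialgebraic {x. \<exists>y. y = f x \<and> y \<in> S}"
    using assms(1) by (intro semialgebraic_Ex semialgebraic_Collect_conj) (auto simp: sa_def)
  then show ?thesis by simp
qed

lemma sa_Pair:
  assumes "sa f" "sa g"
  shows "sa (\<lambda>x. (f x, g x))"
proof -
  have "semialgebraic {z. (fst z, fst (snd z)) \<in> {z. snd z = f (fst z)}}"
    "semialgebraic {z. (fst z, snd (snd z)) \<in> {z. snd z = g (fst z)}}"
    using assms unfolding sa_def
    by (intro semialgebraic_vimage_linear; auto intro: linearI)+
  from semialgebraic_Collect_conj[OF this] show ?thesis
    by (simp add: sa_def prod_eq_iff)
qed

lemma sa_compose: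
  assumes f: "sa f" and g: "sa g"
  shows "sa (\<lambda>x. g (f x))"
proof -
  have "semialgebraic {w. (fst (fst w), snd w) \<in> {z. snd z = f (fst z)}}"
    using f unfolding sa_def by (intro semialgebraic_vimage_linear) (auto intro: linearI)
  then have "sa (\<lambda>z. f (fst z))" by (simp add: sa_def)
  then have "sa (\<lambda>z. (f (fst z), snd z))"
    by (rule sa_Pair[OF _ sa_linear]) (auto intro: linearI)
  from semialgebraic_vimage[OF this, of "{z. snd z = g (fst z)}"] g
  show ?thesis by (simp add: sa_def)
qed

lemma sa_polynomial:
  assumes "real_polynomial_function p"
  shows "sa p"
proof -
  have 1: "polynomial_function (fst :: 'a \<times> real \<Rightarrow> 'a)"
    by (intro polynomial_function_bounded_linear bounded_linear_fst)
  have "real_polynomial_function (\<lambda>z. snd z - (p \<circ> fst) z)"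
    by (intro real_polynomial_function_diff real_polynomial_function_compose[OF 1 assms]
        real_polynomial_function.intros(1) bounded_linear_snd)
  from semialgebraic_polynomial_eq_0[OF this] show ?thesis by (simp add: sa_def)
qed

lemma sa_ident: "sa (\<lambda>x. x)" and sa_fst: "sa fst" and sa_snd: "sa snd"
  by (intro sa_linear; auto intro: linearI)+

lemma sa_const: "sa (\<lambda>x. c)"
proof -
  have "semialgebraic {z. (snd z - c) \<in> {0}}"
    using polynomial_function_diff[OF polynomial_function_bounded_linear[OF bounded_linear_snd]
        polynomial_function_const]
    by (intro semialgebraic_vimage_polynomial[unfolded vimage_def] semialgebraic_singleton_0)
  then show ?thesis by (simp add: sa_def)
qed

lemma sa_fst': "sa f \<Longrightarrow> sa (\<lambda>x. fst (f x))"
  and sa_snd': "sa f \<Longrightarrow> sa (\<lambda>x. snd (f x))"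
  using sa_compose sa_fst sa_snd by blast+

lemma sa_add: "sa f \<Longrightarrow> sa g \<Longrightarrow> sa (\<lambda>x. f x + g x)"
proof -
  assume fg: "sa f" "sa g"
  have "sa (\<lambda>z::'b \<times> 'b. fst z + snd z)" by (intro sa_linear) (auto intro!: linearI simp: algebra_simps)
  from sa_compose[OF sa_Pair[OF fg] this] show ?thesis by simp
qed

lemma sa_diff: "sa f \<Longrightarrow> sa g \<Longrightarrow> sa (\<lambda>x. f x - g x)"
proof -
  assume fg: "sa f" "sa g"
  have "sa (\<lambda>z::'b \<times> 'b. fst z - snd z)" by (intro sa_linear) (auto intro!: linearI simp: algebra_simps)
  from sa_compose[OF sa_Pair[OF fg] this] show ?thesis by simp
qed

lemma sa_mult:
  fixes f g :: "'a::euclidean_space \<Rightarrow> real"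
  shows "sa f \<Longrightarrow> sa g \<Longrightarrow> sa (\<lambda>x. f x * g x)"
proof -
  assume fg: "sa f" "sa g"
  have "sa (\<lambda>z::real \<times> real. fst z * snd z)"
    by (intro sa_polynomial real_polynomial_function.intros(1,4) bounded_linear_fst bounded_linear_snd)
  from sa_compose[OF sa_Pair[OF fg] this] show ?thesis by simp
qed

lemma sa_scaleR_const: "sa f \<Longrightarrow> sa (\<lambda>x. f x *\<^sub>R c)"
  by (rule sa_compose[OF _ sa_linear]) (auto intro!: linearI simp: algebra_simps)

lemma sa_inner_const: "sa f \<Longrightarrow> sa (\<lambda>x. f x \<bullet> c)"
  by (rule sa_compose[OF _ sa_linear]) (auto intro!: linearI simp: inner_add_left)

lemma sa_sum: "finite I \<Longrightarrow> (\<And>i. i \<in> I \<Longrightarrow> sa (f i)) \<Longrightarrow> sa (\<lambda>x. \<Sum>i\<in>I. f i x)"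
  by (induction I rule: finite_induct) (auto intro: sa_const sa_add)

lemma semialgebraic_eq: "sa f \<Longrightarrow> sa g \<Longrightarrow> semialgebraic {x. f x = g x}"
  using semialgebraic_vimage[OF sa_diff semialgebraic_singleton_0, of f g] by simp

lemma semialgebraic_less:
  fixes f g :: "'a::euclidean_space \<Rightarrow> real"
  assumes "sa f" "sa g"
  shows "semialgebraic {x. f x < g x}"
proof -
  have "semialgebraic {t::real. t > 0}"
    by (intro semialgebraic.pos real_polynomial_function.intros(1) bounded_linear_ident)
  from semialgebraic_vimage[OF sa_diff[OF assms(2,1)] this] show ?thesis by simp
qed

lemma semialgebraic_le:
  fixes f g :: "'a::euclidean_space \<Rightarrow> real"
  shows "sa f \<Longrightarrow> sa g \<Longrightarrow> semialgebraic {x. f x \<le> g x}"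
  using semialgebraic_Collect_not[OF semialgebraic_less[of g f]] by (simp add: not_less)

lemma sa_norm:
  assumes "sa (f :: 'a::euclidean_space \<Rightarrow> 'b::euclidean_space)"
  shows "sa (\<lambda>x. norm (f x))"
proof -
  have "semialgebraic {z::'b \<times> real. 0 \<le> snd z \<and> snd z * snd z = (\<Sum>b\<in>Basis. (fst z \<bullet> b) * (fst z \<bullet> b))}"
    by (intro semialgebraic_Collect_conj semialgebraic_le semialgebraic_eq sa_const sa_snd sa_mult
        sa_sum sa_inner_const sa_fst finite_Basis)
  \<comment> \<open>The square root is defined implicitly, as the nonnegative number with the given
    square.\<close>
  moreover have "0 \<le> snd z \<and> snd z * snd z = (\<Sum>b\<in>Basis. (fst z \<bullet> b) * (fst z \<bullet> b)) \<longleftrightarrow> snd z = norm (fst z)"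
    for z :: "'b \<times> real"
  proof -
    have "(\<Sum>b\<in>Basis. (fst z \<bullet> b) * (fst z \<bullet> b)) = (norm (fst z))\<^sup>2"
      by (simp only: euclidean_inner[symmetric] power2_norm_eq_inner)
    then show ?thesis
      using power2_eq_iff_nonneg[of "snd z" "norm (fst z)"] by (auto simp: power2_eq_square)
  qed
  ultimately have "sa (norm :: 'b \<Rightarrow> real)" by (simp add: sa_def)
  from sa_compose[OF assms this] show ?thesis .
qed

lemma sa_dist: "sa f \<Longrightarrow> sa g \<Longrightarrow> sa (\<lambda>x. dist (f x) (g x))"
  unfolding dist_norm by (intro sa_norm sa_diff)

text \<open>These rules follow the syntax of a first-order formula, so an epsilon-delta condition
  becomes semialgebraic once its atoms are.\<close>

lemmas sa_intros = semialgebraic_Ex semialgebraic_All semialgebraic_Collect_conj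
  semialgebraic_Collect_disj semialgebraic_Collect_imp semialgebraic_Collect_not
  semialgebraic_less semialgebraic_le semialgebraic_eq
  sa_dist sa_norm sa_add sa_diff sa_mult sa_const sa_ident sa_fst sa_snd sa_fst' sa_snd' sa_Pair

lemma sa_if:
  assumes "semialgebraic {x. P x}" "sa f" "sa g"
  shows "sa (\<lambda>x. if P x then f x else g x)"
proof -
  have "semialgebraic {z. fst z \<in> {x. P x}}" by (rule semialgebraic_vimage[OF sa_fst assms(1)])
  then have "semialgebraic {z. (fst z \<in> {x. P x} \<longrightarrow> snd z = f (fst z)) \<and>
       (\<not> fst z \<in> {x. P x} \<longrightarrow> snd z = g (fst z))}"
    using assms(2,3) unfolding sa_def
    by (intro semialgebraic_Collect_conj semialgebraic_Collect_imp semialgebraic_Collect_not)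
  then show ?thesis unfolding sa_def by (simp add: if_split)
qed

lemma sa_divide:
  fixes f g :: "'a::euclidean_space \<Rightarrow> real"
  assumes "sa f" "sa g"
  shows "sa (\<lambda>x. f x / g x)"
proof -
  \<comment> \<open>The first conjunct encodes the convention that division by 0 gives 0.\<close>
  have "semialgebraic {z::(real \<times> real) \<times> real. (snd (fst z) = 0 \<longrightarrow> snd z = 0) \<and>
      (\<not> snd (fst z) = 0 \<longrightarrow> snd z * snd (fst z) = fst (fst z))}"
    by (intro sa_intros)
  moreover have "(v = 0 \<longrightarrow> w = 0) \<and> (\<not> v = 0 \<longrightarrow> w * v = u) \<longleftrightarrow> w = u / v" for u v w :: real
    by (auto simp: field_simps)
  ultimately have "sa (\<lambda>z::real \<times> real. fst z / snd z)" by (simp add: sa_def)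
  from sa_compose[OF sa_Pair[OF assms] this] show ?thesis by simp
qed

lemma semialgebraic_on_restrict:
  assumes "sa f" "semialgebraic Q"
  shows "semialgebraic_on Q f"
proof -
  have "semialgebraic {z. fst z \<in> Q \<and> snd z = f (fst z)}"
    using assms semialgebraic_vimage[OF sa_fst assms(2)] unfolding sa_def
    by (intro semialgebraic_Collect_conj)
  moreover have "{z. fst z \<in> Q \<and> snd z = f (fst z)} = {(x, f x) |x. x \<in> Q}" by auto
  ultimately show ?thesis by (simp add: semialgebraic_on_def)
qed

section \<open>Glaeser refinement\<close>

text \<open>The neighbourhoods are not punctured: for \<open>x\<close> in \<open>Q\<close> the point
  \<open>x\<close> itself belongs to them.\<close>

definition near :: "'a::metric_space set \<Rightarrow> 'a \<Rightarrow> 'a filter" where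
  "near Q x = inf (nhds x) (principal Q)"

lemma eventually_near:
  "eventually P (near Q x) \<longleftrightarrow> (\<exists>d>0. \<forall>y\<in>Q. dist y x < d \<longrightarrow> P y)"
  unfolding near_def eventually_inf_principal eventually_nhds_metric by blast

lemma eventually_near_open:
  "eventually P (near Q x) \<longleftrightarrow> (\<exists>U. open U \<and> x \<in> U \<and> (\<forall>y\<in>U \<inter> Q. P y))"
  unfolding near_def eventually_inf_principal eventually_nhds by blast

text \<open>The Kuratowski lower limit, taken along an arbitrary filter so that it applies both to
  neighbourhoods in \<open>Q\<close> and to sequences.\<close>

definition liminf_set :: "'a filter \<Rightarrow> ('a \<Rightarrow> 'b::metric_space set) \<Rightarrow> 'b set" where
  "liminf_set F H = {v. \<forall>e>0. eventually (\<lambda>y. \<exists>w\<in>H y. dist w v < e) F}"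

lemma liminf_setD: "v \<in> liminf_set F H \<Longrightarrow> e > 0 \<Longrightarrow> eventually (\<lambda>y. \<exists>w\<in>H y. dist w v < e) F"
  by (simp add: liminf_set_def)

lemma liminf_set_antimono: "F \<le> F' \<Longrightarrow> liminf_set F' H \<subseteq> liminf_set F H"
  unfolding liminf_set_def by (auto dest: filter_leD)

lemma affine_liminf_set:
  fixes H :: "'a \<Rightarrow> 'b::real_normed_vector set"
  assumes "\<And>y. affine (H y)"
  shows "affine (liminf_set F H)"
  unfolding affine_def
proof (intro ballI allI impI)
  fix v1 v2 and s t :: real
  assume v: "v1 \<in> liminf_set F H" "v2 \<in> liminf_set F H" and st: "s + t = 1"
  show "s *\<^sub>R v1 + t *\<^sub>R v2 \<in> liminf_set F H"
    unfolding liminf_set_def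
  proof (intro CollectI allI impI)
    fix e :: real assume "e > 0"
    define e' where "e' = e / (\<bar>s\<bar> + \<bar>t\<bar> + 1)"
    have e': "e' > 0" "(\<bar>s\<bar> + \<bar>t\<bar> + 1) * e' = e"
      using \<open>e > 0\<close> by (auto simp: e'_def add_nonneg_pos)
    show "eventually (\<lambda>y. \<exists>w\<in>H y. dist w (s *\<^sub>R v1 + t *\<^sub>R v2) < e) F"
      using liminf_setD[OF v(1) e'(1)] liminf_setD[OF v(2) e'(1)]
    proof eventually_elim
      case (elim y)
      then obtain w1 w2 where w: "w1 \<in> H y" "dist w1 v1 < e'" "w2 \<in> H y" "dist w2 v2 < e'" by blast
      have "s *\<^sub>R w1 + t *\<^sub>R w2 \<in> H y" using assms[of y] w st by (simp add: affine_def)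
      moreover have "dist (s *\<^sub>R w1 + t *\<^sub>R w2) (s *\<^sub>R v1 + t *\<^sub>R v2) < e"
      proof -
        have "dist (s *\<^sub>R w1 + t *\<^sub>R w2) (s *\<^sub>R v1 + t *\<^sub>R v2) = norm (s *\<^sub>R (w1 - v1) + t *\<^sub>R (w2 - v2))"
          by (simp add: dist_norm algebra_simps)
        also have "\<dots> \<le> \<bar>s\<bar> * dist w1 v1 + \<bar>t\<bar> * dist w2 v2"
          by (rule order_trans[OF norm_triangle_ineq]) (simp add: dist_norm)
        also have "\<dots> \<le> \<bar>s\<bar> * e' + \<bar>t\<bar> * e'"
          using w by (intro add_mono mult_left_mono) auto
        also have "\<dots> < e" using e' by (simp add: algebra_simps)
        finally show ?thesis .
      qed
      ultimately show ?case by blast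
    qed
  qed
qed

text \<open>The linear map that expands \<open>v\<close> in the orthonormal set \<open>B\<close> and
  replaces each \<open>b\<close> by \<open>c b\<close> moves a nonzero \<open>v\<close> of the span
  by less than \<open>norm v\<close>. Hence it is injective there.\<close>

lemma dim_le_perturbed_basis:
  fixes B :: "'b::euclidean_space set"
  assumes B: "pairwise orthogonal B" "\<And>b. b \<in> B \<Longrightarrow> norm b = 1" "independent B"
    and D: "subspace D" "\<And>b. b \<in> B \<Longrightarrow> c b \<in> D" "\<And>b. b \<in> B \<Longrightarrow> norm (c b - b) < e"
    and e: "e * card B < 1"
  shows "card B \<le> dim D"
proof -
  have finB: "finite B" using B(3) by (rule independent_imp_finite)
  define f where "f v = (\<Sum>b\<in>B. (v \<bullet> b) *\<^sub>R c b)" for v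
  have lin: "linear f"
    unfolding f_def by (auto intro!: linearI simp: inner_add_left scaleR_add_left sum.distrib scaleR_sum_right)
  have "v = 0" if v: "v \<in> span B" "f v = 0" for v
  proof (rule ccontr)
    assume "v \<noteq> 0"
    have "v = (\<Sum>b\<in>B. (v \<bullet> b) *\<^sub>R b)"
      using orthonormal_basis_expand[OF B(1,2) v(1) finB] by simp
    then have "v = (\<Sum>b\<in>B. (v \<bullet> b) *\<^sub>R b) - f v" using v(2) by simp
    also have "\<dots> = (\<Sum>b\<in>B. (v \<bullet> b) *\<^sub>R (b - c b))"
      by (simp add: f_def sum_subtractf scaleR_diff_right)
    finally have "norm v \<le> (\<Sum>b\<in>B. norm ((v \<bullet> b) *\<^sub>R (b - c b)))"
      by (metis norm_sum)
    also have "\<dots> \<le> (\<Sum>b\<in>B. norm v * e)"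
    proof (rule sum_mono)
      fix b assume b: "b \<in> B"
      have "\<bar>v \<bullet> b\<bar> \<le> norm v" using Cauchy_Schwarz_ineq2[of v b] B(2)[OF b] by simp
      then show "norm ((v \<bullet> b) *\<^sub>R (b - c b)) \<le> norm v * e"
        using D(3)[OF b] by (auto simp: norm_minus_commute intro!: mult_mono)
    qed
    also have "\<dots> = norm v * (e * card B)" by simp
    also have "\<dots> < norm v" using \<open>v \<noteq> 0\<close> e by simp
    finally show False by simp
  qed
  then have "inj_on f (span B)"
    using linear_injective_on_subspace_0[OF lin subspace_span] by blast
  then have "dim (f ` B) = dim B" by (rule dim_image_eq[OF lin])
  also have "dim B = card B" using B(3) by (rule dim_eq_card_independent)
  finally have "card B = dim (f ` B)" by simp
  also have "\<dots> \<le> dim D"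
    using D by (intro dim_subset) (auto simp: f_def intro!: subspace_sum subspace_scale)
  finally show ?thesis .
qed

text \<open>Choose \<open>a\<close> in the limit and an orthonormal basis of its direction space.
  Nearby fibres contain points close to \<open>a\<close> and to each \<open>a + b\<close>, and their
  differences are a perturbed basis inside the direction space of the fibre.\<close>

lemma eventually_aff_dim_liminf_set:
  fixes H :: "'a \<Rightarrow> 'b::euclidean_space set"
  assumes aff: "\<And>y. affine (H y)"
  shows "eventually (\<lambda>y. aff_dim (liminf_set F H) \<le> aff_dim (H y)) F"
proof (cases "liminf_set F H = {}")
  case True
  then show ?thesis by (simp add: aff_dim_geq)
next
  case False
  let ?L = "liminf_set F H"
  obtain a where a: "a \<in> ?L" using False by auto
  let ?D = "(\<lambda>v. v - a) ` ?L"
  have "subspace ?D" by (rule affine_diffs_subspace_subtract[OF affine_liminf_set[OF aff] a])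
  then obtain B where B: "B \<subseteq> ?D" "pairwise orthogonal B" "\<And>b. b \<in> B \<Longrightarrow> norm b = 1"
    "independent B" "card B = dim ?D"
    by (metis orthonormal_basis_subspace)
  have finB: "finite B" using B(4) by (rule independent_imp_finite)
  \<comment> \<open>Each difference of two approximating points has error below
    \<open>2 * e\<close>, which must satisfy the smallness condition of
    \<open>dim_le_perturbed_basis\<close>.\<close>
  define e :: real where "e = 1 / (2 * (card B + 1))"
  have e: "e > 0" "2 * e * card B < 1" by (auto simp: e_def field_simps)
  have aB: "a + b \<in> ?L" if "b \<in> B" for b using B(1) that by auto
  have "eventually (\<lambda>y. \<forall>b\<in>B. \<exists>w\<in>H y. dist w (a + b) < e) F"
    using aB e finB by (intro eventually_ball_finite) (auto intro: liminf_setD)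
  then show ?thesis using liminf_setD[OF a e(1)]
  proof eventually_elim
    case (elim y)
    then obtain w0 where w0: "w0 \<in> H y" "dist w0 a < e" by blast
    from elim(1) obtain w where w: "\<And>b. b \<in> B \<Longrightarrow> w b \<in> H y \<and> dist (w b) (a + b) < e" by metis
    have "card B \<le> dim ((\<lambda>v. v - w0) ` H y)"
    proof (rule dim_le_perturbed_basis[OF B(2-4)])
      show "subspace ((\<lambda>v. v - w0) ` H y)" by (rule affine_diffs_subspace_subtract[OF aff w0(1)])
      show "w b - w0 \<in> (\<lambda>v. v - w0) ` H y" if "b \<in> B" for b using w that by auto
      show "norm (w b - w0 - b) < 2 * e" if "b \<in> B" for b
      proof -
        have "w b - w0 - b = (w b - (a + b)) - (w0 - a)" by simp
        then have "norm (w b - w0 - b) \<le> dist (w b) (a + b) + dist w0 a"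
          by (metis dist_norm norm_triangle_ineq4)
        then show ?thesis using w[OF that] w0(2) by linarith
      qed
    qed (use e in auto)
    moreover have "aff_dim ?L = int (dim ?D)"
      using a by (intro aff_dim_eq_dim_subtract hull_inc)
    moreover have "aff_dim (H y) = int (dim ((\<lambda>v. v - w0) ` H y))"
      using w0(1) by (intro aff_dim_eq_dim_subtract hull_inc)
    ultimately show ?case using B(5) by simp
  qed
qed

lemma affine_subset_eq:
  assumes "affine S" "affine T" "S \<subseteq> T" "aff_dim T \<le> aff_dim S"
  shows "S = T"
proof (cases "S = {}")
  case True
  then have "aff_dim T = -1" using assms(4) aff_dim_geq[of T] by simp
  then show ?thesis using True aff_dim_empty[of T] by simp
next
  case False
  then show ?thesis using assms aff_dim_subset[OF assms(3)] by (intro affine_dim_equal) auto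
qed

section \<open>The refinement and its stabilization\<close>

definition glaeser :: "'a::metric_space set \<Rightarrow> ('a \<Rightarrow> 'b::metric_space set) \<Rightarrow> 'a \<Rightarrow> 'b set" where
  "glaeser Q H x = H x \<inter> liminf_set (near Q x) H"

lemma glaeser_subset: "glaeser Q H x \<subseteq> H x"
  by (simp add: glaeser_def)

lemma affine_glaeser:
  fixes H :: "'a::metric_space \<Rightarrow> 'b::real_normed_vector set"
  shows "(\<And>y. affine (H y)) \<Longrightarrow> affine (glaeser Q H x)"
  unfolding glaeser_def by (intro affine_Int affine_liminf_set) auto

lemma eventually_aff_dim_glaeser:
  fixes H :: "'a::metric_space \<Rightarrow> 'b::euclidean_space set"
  assumes "\<And>y. affine (H y)"
  shows "eventually (\<lambda>y. aff_dim (glaeser Q H x) \<le> aff_dim (H y)) (near Q x)"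
  using eventually_aff_dim_liminf_set[of H "near Q x", OF assms]
proof eventually_elim
  case (elim y)
  then show ?case using aff_dim_subset[of "glaeser Q H x" "liminf_set (near Q x) H"]
    by (auto simp: glaeser_def)
qed

lemma glaeser_cong:
  assumes "open U" "x \<in> U" "x \<in> Q" "\<And>y. y \<in> U \<inter> Q \<Longrightarrow> H y = H' y"
  shows "glaeser Q H x = glaeser Q H' x"
proof -
  have *: "eventually (\<lambda>y. H y = H' y) (near Q x)"
    using assms unfolding eventually_near_open by blast
  have "liminf_set (near Q x) H = liminf_set (near Q x) H'"
    unfolding liminf_set_def
    by (intro Collect_cong all_cong1 imp_cong refl eventually_cong[OF *]) simp
  then show ?thesis using assms by (simp add: glaeser_def)
qed

definition glaeser_iter :: "'a::metric_space set \<Rightarrow> ('a \<Rightarrow> 'b::metric_space set) \<Rightarrow> nat \<Rightarrow> 'a \<Rightarrow> 'b set" where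
  "glaeser_iter Q H k = (glaeser Q ^^ k) H"

lemma glaeser_iter_0 [simp]: "glaeser_iter Q H 0 = H"
  and glaeser_iter_Suc [simp]: "glaeser_iter Q H (Suc k) = glaeser Q (glaeser_iter Q H k)"
  by (simp_all add: glaeser_iter_def)

lemma affine_glaeser_iter:
  fixes H :: "'a::metric_space \<Rightarrow> 'b::real_normed_vector set"
  assumes "\<And>y. affine (H y)"
  shows "affine (glaeser_iter Q H k x)"
  using assms by (induction k arbitrary: x) (auto intro: affine_glaeser)

lemma glaeser_iter_antimono: "k \<le> l \<Longrightarrow> glaeser_iter Q H l x \<subseteq> glaeser_iter Q H k x"
  by (induction l rule: dec_induct) (use glaeser_subset in fastforce)+

text \<open>Refinement at a point sees only nearby fibres, so one step without change on an open set
  makes all later steps stationary there.\<close>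

lemma glaeser_iter_stable_local:
  assumes U: "open U" and eq: "\<And>y. y \<in> U \<inter> Q \<Longrightarrow> glaeser_iter Q H (Suc k) y = glaeser_iter Q H k y"
    and "k \<le> l" "x \<in> U \<inter> Q"
  shows "glaeser_iter Q H l x = glaeser_iter Q H k x"
  using assms(3,4)
proof (induction l arbitrary: x rule: dec_induct)
  case (step l)
  have "glaeser Q (glaeser_iter Q H l) x = glaeser Q (glaeser_iter Q H k) x"
    using step U by (intro glaeser_cong[of U]) auto
  then show ?case using eq[OF step.prems] by simp
qed simp

text \<open>Induction on the codimension \<open>j\<close>. A refined fibre of full dimension forces
  all nearby original fibres to be the whole space, which settles \<open>j = 0\<close>. For larger
  \<open>j\<close>, the dimension of a fibre after one further refinement bounds the dimensions of
  nearby fibres before it from below.\<close>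

lemma glaeser_iter_stable:
  fixes H :: "'a::metric_space \<Rightarrow> 'b::euclidean_space set"
  assumes aff: "\<And>y. affine (H y)"
  shows "x \<in> Q \<Longrightarrow> int DIM('b) - int j \<le> aff_dim (glaeser_iter Q H (2 * j + 1) x) \<Longrightarrow> 2 * j + 1 \<le> l
    \<Longrightarrow> glaeser_iter Q H l x = glaeser_iter Q H (2 * j + 1) x"
proof (induction j arbitrary: x l)
  case 0
  let ?G = "glaeser_iter Q H"
  have "eventually (\<lambda>y. aff_dim (glaeser Q H x) \<le> aff_dim (H y)) (near Q x)"
    by (rule eventually_aff_dim_glaeser[OF aff])
  then have "eventually (\<lambda>y. H y = UNIV) (near Q x)"
  proof eventually_elim
    case (elim y)
    then have "aff_dim (H y) = int DIM('b)"
      using 0(2) aff_dim_le_DIM[of "H y"] by simp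
    then have "affine hull H y = UNIV" by (simp add: aff_dim_eq_full)
    then show ?case using aff[of y] by (simp add: affine_hull_eq[THEN iffD2])
  qed
  then obtain U where U: "open U" "x \<in> U" "\<And>y. y \<in> U \<inter> Q \<Longrightarrow> H y = UNIV"
    unfolding eventually_near_open by blast
  have "glaeser Q H y = UNIV" if "y \<in> U \<inter> Q" for y
  proof -
    have "glaeser Q H y = glaeser Q (\<lambda>_. UNIV) y" using that U by (intro glaeser_cong[of U]) auto
    moreover have "\<exists>w. dist w v < e" if "e > 0" for v :: 'b and e
      using that by (intro exI[of _ v]) simp
    ultimately show ?thesis by (simp add: glaeser_def liminf_set_def)
  qed
  then have "?G (Suc 0) y = ?G 0 y" if "y \<in> U \<inter> Q" for y using U that by simp
  from glaeser_iter_stable_local[of U Q H 0, OF U(1) this] have "?G l x = ?G 0 x" "?G 1 x = ?G 0 x"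
    using U 0 by (metis IntI le0)+
  then show ?case by simp
next
  case (Suc j)
  let ?G = "glaeser_iter Q H"
  have affG: "affine (?G k y)" for k y by (rule affine_glaeser_iter[OF aff])
  show ?case
  proof (cases "int DIM('b) - int j \<le> aff_dim (?G (2 * j + 1) x)")
    case True
    have "?G l x = ?G (2 * j + 1) x" "?G (2 * Suc j + 1) x = ?G (2 * j + 1) x"
      using Suc.prems by (intro Suc.IH[OF _ True]; simp)+
    then show ?thesis by simp
  next
    case False
    have "eventually (\<lambda>y. aff_dim (glaeser Q (?G (2 * j + 2)) x) \<le> aff_dim (?G (2 * j + 2) y)) (near Q x)"
      by (rule eventually_aff_dim_glaeser[OF affG])
    then obtain U where U: "open U" "x \<in> U"
      "\<And>y. y \<in> U \<inter> Q \<Longrightarrow> aff_dim (?G (2 * j + 3) x) \<le> aff_dim (?G (2 * j + 2) y)"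
      unfolding eventually_near_open by (auto simp: numeral_3_eq_3)
    \<comment> \<open>Either the fibre at \<open>y\<close> is so large that the induction hypothesis
      applies, or its dimension is at most the lower bound valid for the next refinement on
      \<open>U\<close>. In the second case the nested affine spaces have equal dimension and
      coincide.\<close>
    have "?G (Suc (2 * j + 1)) y = ?G (2 * j + 1) y" if y: "y \<in> U \<inter> Q" for y
    proof (cases "int DIM('b) - int j \<le> aff_dim (?G (2 * j + 1) y)")
      case True
      then show ?thesis using y by (intro Suc.IH) auto
    next
      case False
      have "aff_dim (?G (2 * j + 1) y) \<le> aff_dim (?G (2 * j + 2) y)"
        using False U(3)[OF y] Suc.prems(2) by (simp add: numeral_3_eq_3)
      then show ?thesis
        by (intro affine_subset_eq affG) (auto simp: glaeser_def)
    qed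
    from glaeser_iter_stable_local[of U Q H "2 * j + 1", OF U(1) this]
    have *: "?G l' x = ?G (2 * j + 1) x" if "2 * j + 1 \<le> l'" for l' using that U Suc.prems(1) by blast
    have "?G l x = ?G (2 * j + 1) x" "?G (2 * Suc j + 1) x = ?G (2 * j + 1) x"
      using Suc.prems(3) by (intro *; simp)+
    then show ?thesis by simp
  qed
qed

lemma continuous_section_glaeser_iter:
  assumes "continuous_on Q \<psi>" "\<And>x. x \<in> Q \<Longrightarrow> \<psi> x \<in> H x" "x \<in> Q"
  shows "\<psi> x \<in> glaeser_iter Q H k x"
  using assms(3)
proof (induction k arbitrary: x)
  case (Suc k)
  \<comment> \<open>The nearby witness in the fibre over \<open>y\<close> is the value of the
    section at \<open>y\<close>.\<close>
  have "eventually (\<lambda>y. \<exists>w\<in>glaeser_iter Q H k y. dist w (\<psi> x) < e) (near Q x)" if "e > 0" for e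
  proof -
    obtain d where "d > 0" "\<forall>y\<in>Q. dist y x < d \<longrightarrow> dist (\<psi> y) (\<psi> x) < e"
      using assms(1) Suc.prems \<open>e > 0\<close> unfolding continuous_on_iff by blast
    then show ?thesis unfolding eventually_near using Suc.IH by blast
  qed
  then show ?case using Suc by (simp add: glaeser_def liminf_set_def)
qed (use assms in auto)

section \<open>Definability of the refinement\<close>

definition sa_family :: "('a::euclidean_space \<Rightarrow> 'b::euclidean_space set) \<Rightarrow> bool" where
  "sa_family H \<longleftrightarrow> semialgebraic {z. snd z \<in> H (fst z)}"

lemma semialgebraic_mem_family:
  "sa_family H \<Longrightarrow> sa f \<Longrightarrow> sa g \<Longrightarrow> semialgebraic {x. g x \<in> H (f x)}"
  using semialgebraic_vimage[OF sa_Pair[of f g], of "{z. snd z \<in> H (fst z)}"] by (simp add: sa_family_def)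

lemma sa_family_glaeser:
  assumes "sa_family H" "semialgebraic Q"
  shows "sa_family (glaeser Q H)"
proof -
  have "glaeser Q H x = {v. v \<in> H x \<and> (\<forall>e. 0 < e \<longrightarrow> (\<exists>d. 0 < d \<and> (\<forall>y. y \<in> Q \<longrightarrow>
     dist y x < d \<longrightarrow> (\<exists>w. w \<in> H y \<and> dist w v < e))))}" for x
    unfolding glaeser_def liminf_set_def eventually_near by blast
  then show ?thesis
    unfolding sa_family_def
    by (simp only: mem_Collect_eq)
      (intro sa_intros semialgebraic_mem_family[OF assms(1)] semialgebraic_vimage[OF _ assms(2)])
qed

theorem glaeser_stable_family:
  fixes H :: "'a::euclidean_space \<Rightarrow> 'b::euclidean_space set"
  assumes aff: "\<And>y. affine (H y)" and H: "sa_family H" and Q: "semialgebraic Q"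
  obtains K where "\<And>y. affine (K y)" "sa_family K" "\<And>x. K x \<subseteq> H x"
    "\<And>x. x \<in> Q \<Longrightarrow> K x \<subseteq> liminf_set (near Q x) K"
    "\<And>\<psi> x. continuous_on Q \<psi> \<Longrightarrow> (\<And>x. x \<in> Q \<Longrightarrow> \<psi> x \<in> H x) \<Longrightarrow> x \<in> Q \<Longrightarrow> \<psi> x \<in> K x"
proof -
  \<comment> \<open>This is \<open>2 * j + 1\<close> for \<open>j = DIM('b) + 1\<close>. The
    required dimension \<open>DIM('b) - j\<close> is then -1, which every fibre has, even an empty
    one.\<close>
  define N where "N = 2 * (DIM('b) + 1) + 1"
  let ?K = "glaeser_iter Q H N"
  show thesis
  proof (rule that[of ?K])
    show "affine (?K y)" for y by (rule affine_glaeser_iter[OF aff])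
    show "sa_family ?K"
    proof (induction N)
      case (Suc k)
      then show ?case by (simp add: sa_family_glaeser Q)
    qed (simp add: H)
    show "?K x \<subseteq> H x" for x using glaeser_iter_antimono[of 0 N Q H x] by simp
    show "?K x \<subseteq> liminf_set (near Q x) ?K" if "x \<in> Q" for x
    proof -
      have "glaeser_iter Q H (Suc N) x = ?K x"
        unfolding N_def using that aff_dim_geq
        by (intro glaeser_iter_stable[OF aff]) auto
      then show ?thesis by (auto simp: glaeser_def)
    qed
    show "\<psi> x \<in> ?K x" if "continuous_on Q \<psi>" "\<And>x. x \<in> Q \<Longrightarrow> \<psi> x \<in> H x" "x \<in> Q" for \<psi> x
      using that by (rule continuous_section_glaeser_iter)
  qed
qed

section \<open>Semialgebraic selection\<close>

text \<open>An infimum is the greatest lower bound, a first-order condition. Nonemptiness of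
  \<open>E\<close> and boundedness ensure that \<open>INF\<close> has this meaning.\<close>

lemma sa_INF:
  fixes g :: "'a::euclidean_space \<Rightarrow> 'b::euclidean_space \<Rightarrow> real"
  assumes E: "semialgebraic E" "E \<noteq> {}" and g: "sa (\<lambda>z. g (fst z) (snd z))"
    and bdd: "\<And>x. bdd_below (g x ` E)"
  shows "sa (\<lambda>x. INF y\<in>E. g x y)"
proof -
  have g': "sa (\<lambda>w. g (f1 w) (f2 w))" if "sa f1" "sa f2" for f1 :: "'c::euclidean_space \<Rightarrow> 'a" and f2
    using sa_compose[OF sa_Pair[OF that] g] by simp
  have "semialgebraic {z. (\<forall>y. y \<in> E \<longrightarrow> snd z \<le> g (fst z) y) \<and>
      (\<forall>s. (\<forall>y. y \<in> E \<longrightarrow> s \<le> g (fst z) y) \<longrightarrow> s \<le> snd z)}"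
    by (intro sa_intros g' semialgebraic_vimage[OF _ E(1)])
  moreover have "(\<forall>y. y \<in> E \<longrightarrow> t \<le> g x y) \<and> (\<forall>s. (\<forall>y. y \<in> E \<longrightarrow> s \<le> g x y) \<longrightarrow> s \<le> t)
      \<longleftrightarrow> t = (INF y\<in>E. g x y)" for x t
  proof
    assume "(\<forall>y. y \<in> E \<longrightarrow> t \<le> g x y) \<and> (\<forall>s. (\<forall>y. y \<in> E \<longrightarrow> s \<le> g x y) \<longrightarrow> s \<le> t)"
    then show "t = (INF y\<in>E. g x y)"
      using E(2) by (intro cInf_eq_non_empty[symmetric]) auto
  next
    assume "t = (INF y\<in>E. g x y)"
    then show "(\<forall>y. y \<in> E \<longrightarrow> t \<le> g x y) \<and> (\<forall>s. (\<forall>y. y \<in> E \<longrightarrow> s \<le> g x y) \<longrightarrow> s \<le> t)"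
      using bdd[of x] E(2) by (auto intro: cINF_lower cINF_greatest)
  qed
  ultimately show ?thesis by (simp add: sa_def)
qed

lemma sa_infdist:
  assumes "semialgebraic E" "E \<noteq> {}"
  shows "sa (\<lambda>x. infdist x E)"
proof -
  have "sa (\<lambda>x. INF y\<in>E. dist x y)"
    using assms by (intro sa_INF sa_intros) (auto intro: bdd_belowI[of _ 0])
  then show ?thesis using assms(2) by (simp add: infdist_def)
qed

lemma INF_lipschitz:
  fixes g :: "'a::metric_space \<Rightarrow> 'b \<Rightarrow> real"
  assumes "E \<noteq> {}" "\<And>x. bdd_below (g x ` E)"
    and "\<And>x x' y. y \<in> E \<Longrightarrow> g x y \<le> g x' y + C * dist x x'" "C \<ge> 0"
  shows "C-lipschitz_on UNIV (\<lambda>x. INF y\<in>E. g x y)"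
proof (rule lipschitz_onI)
  have le: "(INF y\<in>E. g x y) \<le> (INF y\<in>E. g x' y) + C * dist x x'" for x x'
  proof -
    have "(INF y\<in>E. g x y) - C * dist x x' \<le> (INF y\<in>E. g x' y)"
    proof (rule cINF_greatest[OF assms(1)])
      fix y assume y: "y \<in> E"
      have "(INF y\<in>E. g x y) \<le> g x y" using assms(2) y by (rule cINF_lower)
      then show "(INF y\<in>E. g x y) - C * dist x x' \<le> g x' y" using assms(3)[OF y, of x x'] by linarith
    qed
    then show ?thesis by linarith
  qed
  show "dist (INF y\<in>E. g x y) (INF y\<in>E. g x' y) \<le> C * dist x x'" for x x'
    using le[of x x'] le[of x' x] by (simp add: dist_real_def abs_le_iff dist_commute)
qed fact

text \<open>Off \<open>E\<close> the extension is the infimum over \<open>y\<close> of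
  \<open>f y\<close> plus the penalty \<open>2 * M * (dist x y / d x - 1)\<close>. The penalty
  vanishes at nearest points and is at least \<open>2 * M\<close> at distance \<open>2 * d x\<close>
  or more, so only values of \<open>f\<close> near \<open>x\<close> matter. This gives continuity at
  \<open>E\<close>.\<close>

lemma sa_Tietze_real:
  fixes f :: "'a::euclidean_space \<Rightarrow> real"
  assumes E: "compact E" "semialgebraic E" "E \<noteq> {}" and f: "sa f" "continuous_on E f"
  obtains F where "sa F" "continuous_on UNIV F" "\<And>x. x \<in> E \<Longrightarrow> F x = f x"
proof -
  have "bounded (f ` E)" using compact_continuous_image[OF f(2) E(1)] by (rule compact_imp_bounded)
  then obtain M where M: "M > 0" "\<And>y. y \<in> E \<Longrightarrow> \<bar>f y\<bar> \<le> M"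
    unfolding bounded_pos by auto
  define d where "d x = infdist x E" for x
  have d: "\<bar>d x - d x'\<bar> \<le> dist x x'" "d x \<ge> 0" for x x'
    unfolding d_def by (auto simp: infdist_triangle_abs infdist_nonneg)
  have d_pos: "d x > 0" if "x \<notin> E" for x
    using that E compact_imp_closed[OF E(1)] infdist_pos_not_in_closed d_def by metis
  have cont_d: "continuous_on UNIV d" unfolding d_def by (intro continuous_intros)
  \<comment> \<open>The penalized value multiplied by \<open>d x\<close> and shifted: this clears
    the denominator, so that the infimum \<open>h\<close> is Lipschitz on the whole space and
    division by \<open>d\<close> is needed only off \<open>E\<close>.\<close>
  define g where "g x y = f y * d x + 2 * M * dist x y" for x y
  define h where "h x = (INF y\<in>E. g x y)" for x
  have g_lower: "- M * d x \<le> g x y" if "y \<in> E" for x y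
  proof -
    have "(f y + M) * d x \<ge> 0" using M(2)[OF that] d(2)[of x] by (intro mult_nonneg_nonneg) auto
    moreover have "2 * M * dist x y \<ge> 0" using M(1) by simp
    ultimately show ?thesis by (simp add: g_def algebra_simps)
  qed
  then have bdd: "bdd_below (g x ` E)" for x by (intro bdd_belowI2)
  have "sa (\<lambda>x. infdist x E)" using E by (intro sa_infdist)
  then have sa_d: "sa d" by (simp add: d_def[abs_def])
  have sa_h: "sa h"
    unfolding h_def g_def
    by (rule sa_INF[OF E(2,3) _ bdd[unfolded g_def]])
      (intro sa_intros sa_compose[OF _ f(1)] sa_compose[OF _ sa_d])
  have "(3 * M)-lipschitz_on UNIV h"
    unfolding h_def
  proof (rule INF_lipschitz[OF E(3) bdd])
    fix x x' y assume y: "y \<in> E"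
    have "f y * (d x - d x') \<le> \<bar>f y\<bar> * \<bar>d x - d x'\<bar>" by (metis abs_ge_self abs_mult)
    also have "\<dots> \<le> M * dist x x'" using M(2)[OF y] d by (intro mult_mono) auto
    finally have 1: "f y * d x \<le> f y * d x' + M * dist x x'" by (simp add: algebra_simps)
    have "dist x y \<le> dist x' y + dist x x'" by (metis add.commute dist_triangle)
    then have "2 * M * dist x y \<le> 2 * M * (dist x' y + dist x x')" using M(1) by (intro mult_left_mono) auto
    then show "g x y \<le> g x' y + 3 * M * dist x x'" using 1 by (simp add: g_def algebra_simps)
  qed (use M in auto)
  then have cont_h: "continuous_on UNIV h" by (rule lipschitz_on_continuous_on)
  define F where "F x = (if x \<in> E then f x else h x / d x - 2 * M)" for x
  have upper: "F x \<le> f y" if "x \<notin> E" "y \<in> E" "dist x y = d x" for x y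
  proof -
    have "h x \<le> g x y" unfolding h_def using bdd that(2) by (rule cINF_lower)
    then have "h x \<le> (f y + 2 * M) * d x" using that by (simp add: g_def algebra_simps)
    then show ?thesis using that d_pos by (simp add: F_def field_simps)
  qed
  \<comment> \<open>For \<open>y\<close> at distance at least \<open>2 * d x\<close> the penalized
    value is at least \<open>- M + 2 * M = M\<close>, hence the condition that \<open>c\<close> be
    at most \<open>M\<close>.\<close>
  have lower: "c \<le> F x" if x: "x \<notin> E" and c: "c \<le> M" "\<And>y. y \<in> E \<Longrightarrow> dist x y < 2 * d x \<Longrightarrow> c \<le> f y" for c x
  proof -
    have "(c + 2 * M) * d x \<le> h x"
      unfolding h_def
    proof (rule cINF_greatest[OF E(3)])
      fix y assume y: "y \<in> E"
      show "(c + 2 * M) * d x \<le> g x y"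
      proof (cases "dist x y < 2 * d x")
        case True
        have "c * d x \<le> f y * d x" using c(2)[OF y True] d by (intro mult_right_mono) auto
        moreover have "2 * M * d x \<le> 2 * M * dist x y"
          using M(1) infdist_le[OF y, of x] by (intro mult_left_mono) (auto simp: d_def)
        ultimately show ?thesis by (simp add: g_def algebra_simps)
      next
        case False
        have "2 * M * (2 * d x) \<le> 2 * M * dist x y" using False M(1) by (intro mult_left_mono) auto
        moreover have "(c + 2 * M) * d x \<le> (f y + 4 * M) * d x"
          using c(1) M(2)[OF y] d by (intro mult_right_mono) auto
        ultimately show ?thesis by (simp add: g_def algebra_simps)
      qed
    qed
    then show ?thesis using x d_pos by (simp add: F_def field_simps)
  qed
  have "isCont F x0" for x0
  proof (cases "x0 \<in> E")
    case False
    have "open (- E)" using compact_imp_closed[OF E(1)] by auto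
    then have "eventually (\<lambda>x. x \<in> - E) (nhds x0)" using False by (intro eventually_nhds_in_open) auto
    then have "eventually (\<lambda>x. F x = h x / d x - 2 * M) (nhds x0)"
      by eventually_elim (auto simp: F_def)
    moreover have "isCont (\<lambda>x. h x / d x - 2 * M) x0"
      using cont_h cont_d d_pos[OF False] by (intro continuous_intros) (auto simp: continuous_on_eq_continuous_at)
    ultimately show ?thesis using isCont_cong[of F "\<lambda>x. h x / d x - 2 * M" x0] by simp
  next
    case True
    show ?thesis
      unfolding continuous_at_eps_delta dist_norm[symmetric]
    proof (intro allI impI)
      fix e :: real assume "e > 0"
      then obtain \<delta> where \<delta>: "\<delta> > 0" "\<And>y. y \<in> E \<Longrightarrow> dist y x0 < \<delta> \<Longrightarrow> dist (f y) (f x0) < e / 2"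
        using f(2) True unfolding continuous_on_iff by (meson half_gt_zero)
      \<comment> \<open>Relevant points of \<open>E\<close> lie within \<open>2 * d x\<close> of
        \<open>x\<close>. Since \<open>d x\<close> and \<open>dist x x0\<close> are both below a
        third of \<open>\<delta>\<close>, these points lie within \<open>\<delta>\<close> of
        \<open>x0\<close>.\<close>
      have "dist (F x) (F x0) < e" if x: "dist x x0 < \<delta> / 3" for x
      proof (cases "x \<in> E")
        case True
        then show ?thesis using \<delta>(2)[OF True] x \<delta>(1) \<open>x0 \<in> E\<close> \<open>e > 0\<close> by (simp add: F_def)
      next
        case False
        have dx: "d x < \<delta> / 3" using infdist_le[OF True, of x] x by (simp add: d_def)
        obtain y where y: "y \<in> E" "infdist x E = dist x y"
          using infdist_attains_inf[OF compact_imp_closed[OF E(1)] E(3)] by blast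
        have "dist y x0 < \<delta>" using dist_triangle[of y x0 x] y dx x \<delta>(1) by (simp add: d_def dist_commute)
        then have "F x \<le> f y" "\<bar>f y - f x0\<bar> < e / 2"
          using upper[OF False y(1)] y \<delta>(2)[OF y(1)] by (simp_all add: d_def dist_real_def)
        then have "F x < f x0 + e / 2" by linarith
        moreover have "f x0 - e / 2 \<le> F x"
        proof (rule lower[OF False])
          show "f x0 - e / 2 \<le> M" using M(2)[OF True] \<open>e > 0\<close> by linarith
          fix z assume z: "z \<in> E" "dist x z < 2 * d x"
          have "dist z x0 < \<delta>" using dist_triangle[of z x0 x] z dx x by (simp add: dist_commute)
          then have "\<bar>f z - f x0\<bar> < e / 2" using \<delta>(2)[OF z(1)] by (simp add: dist_real_def)
          then show "f x0 - e / 2 \<le> f z" by linarith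
        qed
        ultimately have "\<bar>F x - f x0\<bar> < e" using \<open>e > 0\<close> by linarith
        then show ?thesis using True by (simp add: F_def dist_real_def)
      qed
      then show "\<exists>d>0. \<forall>x. dist x x0 < d \<longrightarrow> dist (F x) (F x0) < e"
        using \<delta>(1) by (intro exI[of _ "\<delta> / 3"]) auto
    qed
  qed
  then have "continuous_on UNIV F" by (simp add: continuous_on_eq_continuous_at)
  moreover have "sa F"
    unfolding F_def
    by (intro sa_if sa_intros sa_divide f(1) sa_h sa_d) (use E(2) in simp)
  moreover have "F x = f x" if "x \<in> E" for x using that by (simp add: F_def)
  ultimately show ?thesis using that by blast
qed

lemma sa_Tietze:
  fixes f :: "'a::euclidean_space \<Rightarrow> 'b::euclidean_space"
  assumes E: "compact E" "semialgebraic E" and f: "sa f" "continuous_on E f"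
  obtains F where "sa F" "continuous_on UNIV F" "\<And>x. x \<in> E \<Longrightarrow> F x = f x"
proof (cases "E = {}")
  case True
  then show ?thesis by (intro that[of "\<lambda>_. 0"]) (auto intro: sa_const)
next
  case False
  have "\<exists>F. sa F \<and> continuous_on UNIV F \<and> (\<forall>x\<in>E. F x = f x \<bullet> b)" for b
    by (rule sa_Tietze_real[OF E False, of "\<lambda>x. f x \<bullet> b"])
      (auto intro!: sa_inner_const f continuous_intros)
  then obtain F where F: "\<And>b. sa (F b)" "\<And>b. continuous_on UNIV (F b)" "\<And>b x. x \<in> E \<Longrightarrow> F b x = f x \<bullet> b"
    by metis
  show ?thesis
  proof (rule that[of "\<lambda>x. \<Sum>b\<in>Basis. F b x *\<^sub>R b"])
    show "sa (\<lambda>x. \<Sum>b\<in>Basis. F b x *\<^sub>R b)" by (intro sa_sum sa_scaleR_const F(1) finite_Basis)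
    show "continuous_on UNIV (\<lambda>x. \<Sum>b\<in>Basis. F b x *\<^sub>R b)" by (intro continuous_intros F(2))
  qed (simp add: F(3) euclidean_representation)
qed

section \<open>Upper semicontinuity and continuity of nearest points\<close>

text \<open>Outer semicontinuity in the sense of Kuratowski: no point outside the fibre at
  \<open>x\<close> is a limit of points of nearby fibres. It does not bound the nearby fibres, and
  it is spelled out with quantifiers so that it is visibly first-order.\<close>

definition usc_at :: "'a::metric_space set \<Rightarrow> ('a \<Rightarrow> 'b::metric_space set) \<Rightarrow> 'a \<Rightarrow> bool" where
  "usc_at E K x \<longleftrightarrow> (\<forall>p. p \<notin> K x \<longrightarrow> (\<exists>e>0. \<exists>d>0. \<forall>y. y \<in> E \<longrightarrow> dist y x < d \<longrightarrow>
      (\<forall>q. q \<in> K y \<longrightarrow> e \<le> dist q p)))"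

text \<open>If points of fibres over a sequence tended to some \<open>p\<close> outside
  \<open>K x\<close>, the lower limit along that sequence would contain both \<open>K x\<close> and
  \<open>p\<close>. Its dimension would exceed that of \<open>K x\<close>, yet it is at most the
  dimension of the fibres over the sequence, which is the same.\<close>

lemma usc_at_const_aff_dim:
  fixes K :: "'a::metric_space \<Rightarrow> 'b::euclidean_space set"
  assumes aff: "\<And>y. affine (K y)" and lsc: "K x \<subseteq> liminf_set (near E x) K"
    and dim: "eventually (\<lambda>y. aff_dim (K y) = aff_dim (K x)) (near E x)"
  shows "usc_at E K x"
proof (rule ccontr)
  assume "\<not> usc_at E K x"
  then obtain p where p: "p \<notin> K x"
    "\<And>e d. e > 0 \<Longrightarrow> d > 0 \<Longrightarrow> \<exists>y\<in>E. dist y x < d \<and> (\<exists>q\<in>K y. dist q p < e)"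
    unfolding usc_at_def by (metis not_le)
  have "\<forall>n. \<exists>y\<in>E. dist y x < inverse (real (Suc n)) \<and> (\<exists>q\<in>K y. dist q p < inverse (real (Suc n)))"
    by (intro allI p(2)) auto
  then obtain y where y: "\<And>n. y n \<in> E" "\<And>n. dist (y n) x < inverse (real (Suc n))"
    "\<And>n. \<exists>q\<in>K (y n). dist q p < inverse (real (Suc n))" by metis
  define F where "F = filtermap y sequentially"
  have small: "eventually (\<lambda>n. inverse (real (Suc n)) < e) sequentially" if "e > 0" for e
    using LIMSEQ_inverse_real_of_nat order_tendstoD(2) that by blast
  have "F \<le> near E x"
  proof (rule filter_leI)
    fix P assume "eventually P (near E x)"
    then obtain d where d: "d > 0" "\<And>y. y \<in> E \<Longrightarrow> dist y x < d \<Longrightarrow> P y" unfolding eventually_near by blast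
    from small[OF d(1)] show "eventually P F"
      unfolding F_def eventually_filtermap
    proof eventually_elim
      case (elim n)
      then show ?case using y(1,2)[of n] by (intro d(2)) auto
    qed
  qed
  then have "K x \<subseteq> liminf_set F K" using lsc liminf_set_antimono by blast
  moreover have "p \<in> liminf_set F K"
    unfolding liminf_set_def F_def eventually_filtermap
  proof (intro CollectI allI impI)
    fix e :: real assume "e > 0"
    from small[OF this] show "eventually (\<lambda>n. \<exists>w\<in>K (y n). dist w p < e) sequentially"
    proof eventually_elim
      case (elim n)
      then show ?case using y(3)[of n] by (meson less_trans)
    qed
  qed
  ultimately have "aff_dim (K x) < aff_dim (liminf_set F K)"
    using affine_subset_eq[of "K x" "liminf_set F K"] aff affine_liminf_set[of K F, OF aff] p(1)
    by (metis not_le)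
  moreover have "eventually (\<lambda>y. aff_dim (liminf_set F K) \<le> aff_dim (K y)) F"
    by (rule eventually_aff_dim_liminf_set[OF aff])
  moreover have "eventually (\<lambda>y. aff_dim (K y) = aff_dim (K x)) F"
    using dim \<open>F \<le> near E x\<close> by (rule filter_leD[rotated])
  ultimately have "eventually (\<lambda>_. False) F" by (auto elim: eventually_elim2)
  then show False by (simp add: F_def eventually_filtermap)
qed

lemma closest_point_affine:
  fixes S :: "'b::euclidean_space set"
  assumes "affine S" "S \<noteq> {}"
  shows "closest_point S a \<in> S" "\<And>w. w \<in> S \<Longrightarrow> dist (closest_point S a) a \<le> dist w a"
proof -
  have "closed S" using assms(1) by (rule affine_closed)
  then show "closest_point S a \<in> S" "\<And>w. w \<in> S \<Longrightarrow> dist (closest_point S a) a \<le> dist w a"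
    using closest_point_in_set closest_point_le assms(2) by (metis, metis dist_commute)
qed

text \<open>If \<open>F x\<close> lies in the fibre, lower semicontinuity gives points of nearby
  fibres close to \<open>F x\<close>. The nearest point to \<open>F y\<close> can be no farther from
  \<open>F y\<close> than these.\<close>

lemma continuous_closest_point_section:
  fixes K :: "'a::metric_space \<Rightarrow> 'b::euclidean_space set"
  assumes aff: "\<And>y. affine (K y)" and ne: "\<And>y. y \<in> E \<Longrightarrow> K y \<noteq> {}" and x: "x \<in> E" "F x \<in> K x"
    and lsc: "K x \<subseteq> liminf_set (near E x) K" and F: "continuous_on UNIV F"
  shows "continuous (at x within E) (\<lambda>y. closest_point (K y) (F y))"
  unfolding continuous_within_eps_delta dist_norm[symmetric]
proof (intro allI impI)
  fix e :: real assume "e > 0"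
  have self: "closest_point (K x) (F x) = F x" using x(2) by (rule closest_point_self)
  have "eventually (\<lambda>y. \<exists>w\<in>K y. dist w (F x) < e / 2) (near E x)"
    using lsc x(2) \<open>e > 0\<close> by (intro liminf_setD) auto
  then obtain d1 where d1: "d1 > 0" "\<And>y. y \<in> E \<Longrightarrow> dist y x < d1 \<Longrightarrow> \<exists>w\<in>K y. dist w (F x) < e / 2"
    unfolding eventually_near by blast
  \<comment> \<open>The displacement of \<open>F\<close> enters twice through the triangle
    inequality, on top of the \<open>e / 2\<close> for \<open>w\<close>.\<close>
  obtain d2 where d2: "d2 > 0" "\<And>y. dist y x < d2 \<Longrightarrow> dist (F y) (F x) < e / 4"
    using F \<open>e > 0\<close> unfolding continuous_on_iff by (metis UNIV_I divide_pos_pos zero_less_numeral)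
  have "dist (closest_point (K y) (F y)) (closest_point (K x) (F x)) < e"
    if y: "y \<in> E" "dist y x < min d1 d2" for y
  proof -
    obtain w where w: "w \<in> K y" "dist w (F x) < e / 2" using d1(2)[of y] y by auto
    have "dist (closest_point (K y) (F y)) (F y) \<le> dist w (F y)"
      using closest_point_affine(2)[OF aff ne[OF y(1)] w(1)] .
    also have "\<dots> \<le> dist w (F x) + dist (F y) (F x)" by (metis dist_commute dist_triangle)
    finally show ?thesis
      using w(2) d2(2)[of y] y(2) dist_triangle[of "closest_point (K y) (F y)" "F x" "F y"]
      unfolding self by (simp add: min_def split: if_splits)
  qed
  then show "\<exists>d>0. \<forall>x'\<in>E. dist x' x < d \<longrightarrow>
      dist (closest_point (K x') (F x')) (closest_point (K x) (F x)) < e"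
    using d1(1) d2(1) by (intro exI[of _ "min d1 d2"]) auto
qed

text \<open>Lower semicontinuity provides competitors that keep nearest points bounded along a
  sequence tending to \<open>x\<close>. A subsequential limit lies in \<open>K x\<close> by upper
  semicontinuity and is at least as close to \<open>F x\<close> as the nearest point, so it equals
  that point by uniqueness.\<close>

lemma continuous_closest_point_usc:
  fixes K :: "'a::metric_space \<Rightarrow> 'b::euclidean_space set"
  assumes aff: "\<And>y. affine (K y)" and ne: "\<And>y. y \<in> E \<Longrightarrow> K y \<noteq> {}" and x: "x \<in> E"
    and lsc: "K x \<subseteq> liminf_set (near E x) K" and usc: "usc_at E K x" and F: "continuous_on UNIV F"
  shows "continuous (at x within E) (\<lambda>y. closest_point (K y) (F y))"
proof (rule ccontr)
  let ?u = "\<lambda>y. closest_point (K y) (F y)"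
  define c where "c = ?u x"
  assume "\<not> continuous (at x within E) ?u"
  then obtain e where e: "e > 0" "\<And>d. d > 0 \<Longrightarrow> \<exists>y\<in>E. dist y x < d \<and> e \<le> dist (?u y) c"
    unfolding continuous_within_eps_delta dist_norm[symmetric] c_def by (metis not_le)
  have "\<forall>n. \<exists>y\<in>E. dist y x < inverse (real (Suc n)) \<and> e \<le> dist (?u y) c"
    by (intro allI e(2)) auto
  then obtain y where y: "\<And>n. y n \<in> E" "\<And>n. dist (y n) x < inverse (real (Suc n))"
    "\<And>n. e \<le> dist (?u (y n)) c" by metis
  have "y \<longlonglongrightarrow> x"
  proof (rule tendstoI)
    fix d :: real assume "d > 0"
    then have "eventually (\<lambda>n. inverse (real (Suc n)) < d) sequentially"
      using LIMSEQ_inverse_real_of_nat order_tendstoD(2) by blast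
    then show "eventually (\<lambda>n. dist (y n) x < d) sequentially"
    proof eventually_elim
      case (elim n)
      show ?case using y(2)[of n] elim by (rule less_trans)
    qed
  qed
  have near: "eventually (\<lambda>n. P (y n)) sequentially" if P: "eventually P (near E x)" for P
  proof -
    obtain d where d: "d > 0" "\<And>y. y \<in> E \<Longrightarrow> dist y x < d \<Longrightarrow> P y"
      using P unfolding eventually_near by blast
    from tendstoD[OF \<open>y \<longlonglongrightarrow> x\<close> d(1)] show ?thesis by eventually_elim (rule d(2)[OF y(1)])
  qed
  have cK: "c \<in> K x" unfolding c_def using aff ne[OF x] by (rule closest_point_affine)
  \<comment> \<open>The competitors: points of the fibres over \<open>y n\<close> converging to the
    nearest point \<open>c\<close> over \<open>x\<close>.\<close>
  define w where "w n = closest_point (K (y n)) c" for n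
  have "w \<longlonglongrightarrow> c"
  proof (rule tendstoI)
    fix \<epsilon> :: real assume "\<epsilon> > 0"
    then have "eventually (\<lambda>z. \<exists>v\<in>K z. dist v c < \<epsilon>) (near E x)"
      using lsc cK by (intro liminf_setD) auto
    from near[OF this] show "eventually (\<lambda>n. dist (w n) c < \<epsilon>) sequentially"
    proof eventually_elim
      case (elim n)
      then obtain v where v: "v \<in> K (y n)" "dist v c < \<epsilon>" by blast
      have "dist (w n) c \<le> dist v c"
        unfolding w_def using closest_point_affine(2)[OF aff ne[OF y(1)] v(1)] .
      then show ?case using v(2) by linarith
    qed
  qed
  have Fy: "(\<lambda>n. F (y n)) \<longlonglongrightarrow> F x"
    using F \<open>y \<longlonglongrightarrow> x\<close> by (auto intro: continuous_on_tendsto_compose)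
  have le: "dist (?u (y n)) (F (y n)) \<le> dist (w n) (F (y n))" for n
    unfolding w_def
    by (rule closest_point_affine(2)[OF aff ne[OF y(1)] closest_point_affine(1)[OF aff ne[OF y(1)]]])
  have "(\<lambda>n. dist (w n) (F (y n)) + dist (F (y n)) (F x)) \<longlonglongrightarrow> dist c (F x) + dist (F x) (F x)"
    by (intro tendsto_intros \<open>w \<longlonglongrightarrow> c\<close> Fy)
  then have "bounded (range (\<lambda>n. dist (w n) (F (y n)) + dist (F (y n)) (F x)))"
    by (rule convergent_imp_bounded)
  then obtain B where B: "\<And>n. dist (w n) (F (y n)) + dist (F (y n)) (F x) \<le> B"
    unfolding bounded_iff by (auto simp: abs_le_iff)
  have "dist (F x) (?u (y n)) \<le> B" for n
    using dist_triangle[of "?u (y n)" "F x" "F (y n)"] le[of n] B[of n] by (simp add: dist_commute)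
  then have "bounded (range (\<lambda>n. ?u (y n)))" unfolding bounded_def by auto
  then obtain p r where r: "strict_mono r" "((\<lambda>n. ?u (y n)) \<circ> r) \<longlonglongrightarrow> p"
    using bounded_imp_convergent_subsequence by blast
  have pK: "p \<in> K x"
  proof (rule ccontr)
    assume "p \<notin> K x"
    then obtain \<epsilon> d where \<epsilon>: "\<epsilon> > 0" "d > 0"
      "\<And>z q. z \<in> E \<Longrightarrow> dist z x < d \<Longrightarrow> q \<in> K z \<Longrightarrow> \<epsilon> \<le> dist q p"
      using usc unfolding usc_at_def by meson
    have "eventually (\<lambda>n. dist (y n) x < d) sequentially" using \<open>y \<longlonglongrightarrow> x\<close> \<epsilon>(2) by (rule tendstoD)
    then have "eventually (\<lambda>n. dist (y (r n)) x < d) sequentially" by (rule eventually_subseq[OF r(1)])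
    moreover have "eventually (\<lambda>n. dist (?u (y (r n))) p < \<epsilon>) sequentially"
      using tendstoD[OF r(2) \<epsilon>(1)] by simp
    ultimately have "eventually (\<lambda>_. False) sequentially"
    proof eventually_elim
      case (elim n)
      then show ?case
        using \<epsilon>(3)[OF y(1) elim(1) closest_point_affine(1)[OF aff ne[OF y(1)]]] by (meson not_le)
    qed
    then show False by simp
  qed
  have "dist p (F x) \<le> dist c (F x)"
  proof (rule LIMSEQ_le)
    show "(\<lambda>n. dist (?u (y (r n))) (F (y (r n)))) \<longlonglongrightarrow> dist p (F x)"
      using r(2) LIMSEQ_subseq_LIMSEQ[OF Fy r(1)] by (intro tendsto_dist) (auto simp: o_def)
    show "(\<lambda>n. dist (w (r n)) (F (y (r n)))) \<longlonglongrightarrow> dist c (F x)"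
      using LIMSEQ_subseq_LIMSEQ[OF \<open>w \<longlonglongrightarrow> c\<close> r(1)] LIMSEQ_subseq_LIMSEQ[OF Fy r(1)]
      by (intro tendsto_dist) (auto simp: o_def)
  qed (use le in blast)
  then have "dist (F x) p \<le> dist (F x) z" if "z \<in> K x" for z
    using closest_point_affine(2)[OF aff ne[OF x] that, of "F x"] by (simp add: c_def dist_commute)
  then have "p = c"
    unfolding c_def using aff pK by (intro closest_point_unique) (auto simp: affine_imp_convex affine_closed)
  moreover have "e \<le> dist p c"
  proof (rule LIMSEQ_le_const)
    show "(\<lambda>n. dist (?u (y (r n))) c) \<longlonglongrightarrow> dist p c"
      using r(2) by (intro tendsto_dist tendsto_const) (auto simp: o_def)
  qed (use y(3) in blast)
  ultimately show False using e(1) by simp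
qed

section \<open>Constructing the section by induction on the fibre dimension\<close>

text \<open>The induction runs over all compact semialgebraic \<open>E\<close> in \<open>Q\<close>
  with a strict bound \<open>n\<close> on fibre dimensions; lower semicontinuity and nonemptiness
  pass to subsets. At \<open>n = 0\<close> the set is empty, since a nonempty fibre has dimension at
  least 0.\<close>

theorem semialgebraic_affine_selection:
  fixes K :: "'a::euclidean_space \<Rightarrow> 'b::euclidean_space set"
  assumes aff: "\<And>y. affine (K y)" and K: "sa_family K"
    and lsc: "\<And>x. x \<in> Q \<Longrightarrow> K x \<subseteq> liminf_set (near Q x) K"
    and ne: "\<And>x. x \<in> Q \<Longrightarrow> K x \<noteq> {}" and Q: "compact Q" "semialgebraic Q"
  obtains f where "sa f" "continuous_on Q f" "\<And>x. x \<in> Q \<Longrightarrow> f x \<in> K x"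
proof -
  have "\<exists>f. sa f \<and> continuous_on E f \<and> (\<forall>x\<in>E. f x \<in> K x)"
    if "compact E" "semialgebraic E" "E \<subseteq> Q" "\<And>x. x \<in> E \<Longrightarrow> aff_dim (K x) < int n" for n E
    using that
  proof (induction n arbitrary: E)
    case 0
    have "E = {}"
    proof (rule ccontr)
      assume "E \<noteq> {}"
      then obtain x where x: "x \<in> E" by blast
      then have "K x \<noteq> {}" using 0(3) ne by blast
      then have "aff_dim (K x) \<noteq> -1" using aff_dim_empty by blast
      moreover have "aff_dim (K x) < 0" using 0(4)[OF x] by simp
      ultimately show False using aff_dim_geq[of "K x"] by linarith
    qed
    then show ?case by (auto intro: sa_const)
  next
    case (Suc n)
    have lscE: "K x \<subseteq> liminf_set (near E x) K" if "x \<in> E" for x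
    proof -
      have "near E x \<le> near Q x" unfolding near_def using Suc.prems(3) by (intro inf_mono) auto
      then show ?thesis using lsc[of x] Suc.prems(3) that liminf_set_antimono by blast
    qed
    have neE: "K x \<noteq> {}" if "x \<in> E" for x using ne that Suc.prems(3) by blast
    \<comment> \<open>Upper semicontinuity is a first-order condition, so \<open>E'\<close> is semialgebraic;
      this avoids having to express the dimension of a fibre by a formula.\<close>
    define E' where "E' = E \<inter> closure {x. x \<in> E \<and> \<not> usc_at E K x}"
    have compE': "compact E'" unfolding E'_def using Suc.prems(1) by (intro compact_Int_closed) auto
    have mem: "semialgebraic {x. x \<in> E}" using Suc.prems(2) by simp
    have usc_sa: "semialgebraic {x. usc_at E K x}"
      unfolding usc_at_def
      by (intro sa_intros semialgebraic_mem_family[OF K] semialgebraic_vimage[OF _ Suc.prems(2)])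
    have saE': "semialgebraic E'"
    proof -
      have "E' = {x. x \<in> E \<and> (\<forall>e>0. \<exists>y. (y \<in> E \<and> \<not> usc_at E K y) \<and> dist y x < e)}"
        by (auto simp: E'_def closure_approachable Bex_def)
      moreover have "semialgebraic {y. y \<in> E \<and> \<not> usc_at E K y}"
        by (intro semialgebraic_Collect_conj semialgebraic_Collect_not usc_sa mem)
      from semialgebraic_vimage[OF _ this]
      have bad: "semialgebraic {x. h x \<in> E \<and> \<not> usc_at E K (h x)}" if "sa h" for h :: "'c::euclidean_space \<Rightarrow> 'a"
        using that by simp
      then have "semialgebraic {x. x \<in> E \<and> (\<forall>e>0. \<exists>y. (y \<in> E \<and> \<not> usc_at E K y) \<and> dist y x < e)}"
        by (intro semialgebraic_Collect_conj[OF mem] semialgebraic_All semialgebraic_Collect_imp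
            semialgebraic_Ex semialgebraic_Collect_conj[OF bad] sa_intros)
      ultimately show ?thesis by simp
    qed
    have "aff_dim (K x) < int n" if "x \<in> E'" for x
    proof (rule ccontr)
      assume "\<not> aff_dim (K x) < int n"
      then have x: "x \<in> E" "aff_dim (K x) = int n" using Suc.prems(4)[of x] that by (auto simp: E'_def)
      \<comment> \<open>A fibre of the maximal dimension \<open>n\<close> forces dimension
        \<open>n\<close> nearby. The bundle is then upper semicontinuous on a whole neighbourhood in
        \<open>E\<close>, which keeps \<open>x\<close> out of the closure defining
        \<open>E'\<close>.\<close>
      have "eventually (\<lambda>y. aff_dim (liminf_set (near E x) K) \<le> aff_dim (K y)) (near E x)"
        by (rule eventually_aff_dim_liminf_set[OF aff])
      then have "eventually (\<lambda>y. int n \<le> aff_dim (K y)) (near E x)"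
        using aff_dim_subset[OF lscE[OF x(1)]] x(2) by (auto elim: eventually_mono)
      then obtain U where U: "open U" "x \<in> U" "\<And>y. y \<in> U \<inter> E \<Longrightarrow> int n \<le> aff_dim (K y)"
        unfolding eventually_near_open by blast
      then have U': "aff_dim (K y) = int n" if "y \<in> U \<inter> E" for y
      proof -
        have "aff_dim (K y) < int (Suc n)" using Suc.prems(4) that by blast
        then show ?thesis using U(3)[OF that] by linarith
      qed
      have "usc_at E K y" if "y \<in> U \<inter> E" for y
        using that U U' by (intro usc_at_const_aff_dim aff lscE)
          (auto simp: eventually_near_open intro!: exI[of _ U])
      then have "U \<inter> {x. x \<in> E \<and> \<not> usc_at E K x} = {}" by blast
      then have "U \<inter> closure {x. x \<in> E \<and> \<not> usc_at E K x} = {}"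
        using U(1) by (simp add: open_Int_closure_eq_empty)
      then show False using that U(2) by (auto simp: E'_def)
    qed
    moreover have "E' \<subseteq> Q" using Suc.prems(3) by (auto simp: E'_def)
    ultimately obtain f where f: "sa f" "continuous_on E' f" "\<forall>x\<in>E'. f x \<in> K x"
      using Suc.IH[OF compE' saE'] by blast
    obtain F where F: "sa F" "continuous_on UNIV F" "\<And>x. x \<in> E' \<Longrightarrow> F x = f x"
      using sa_Tietze[OF compE' saE' f(1,2)] by blast
    \<comment> \<open>The value 0 outside \<open>E\<close> makes \<open>g\<close> a total function,
      as the statement \<open>sa g\<close> requires.\<close>
    define g where "g x = (if x \<in> E then closest_point (K x) (F x) else 0)" for x
    have gK: "g x \<in> K x" if "x \<in> E" for x
      using closest_point_affine(1)[OF aff neE[OF that]] that by (simp add: g_def)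
    have "continuous (at x within E) (\<lambda>y. closest_point (K y) (F y))" if "x \<in> E" for x
    proof (cases "x \<in> E'")
      case True
      then show ?thesis
        using f(3) F(3) that by (intro continuous_closest_point_section aff neE lscE F(2)) auto
    next
      case False
      then have "usc_at E K x"
        using that closure_subset[of "{x. x \<in> E \<and> \<not> usc_at E K x}"] by (auto simp: E'_def)
      then show ?thesis using that by (intro continuous_closest_point_usc aff neE lscE F(2)) auto
    qed
    then have "continuous_on E (\<lambda>y. closest_point (K y) (F y))"
      by (simp add: continuous_on_eq_continuous_within)
    then have "continuous_on E g" by (rule continuous_on_eq) (simp add: g_def)
    moreover have "sa g"
    proof -
      \<comment> \<open>The nearest point is described by its minimality. Uniqueness in the closed
        convex fibre identifies this formula with the graph of \<open>g\<close>.\<close>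
      have "semialgebraic {z. (fst z \<in> E \<longrightarrow> snd z \<in> K (fst z) \<and>
          (\<forall>q. q \<in> K (fst z) \<longrightarrow> dist (F (fst z)) (snd z) \<le> dist (F (fst z)) q)) \<and>
          (fst z \<notin> E \<longrightarrow> snd z = 0)}"
        by (intro sa_intros semialgebraic_mem_family[OF K] semialgebraic_vimage[OF _ Suc.prems(2)]
            sa_compose[OF _ F(1)])
      moreover have "(x \<in> E \<longrightarrow> v \<in> K x \<and> (\<forall>q. q \<in> K x \<longrightarrow> dist (F x) v \<le> dist (F x) q)) \<and>
          (x \<notin> E \<longrightarrow> v = 0) \<longleftrightarrow> v = g x" for x v
      proof (cases "x \<in> E")
        case True
        have "v = closest_point (K x) (F x)"
          if "v \<in> K x" "\<forall>q. q \<in> K x \<longrightarrow> dist (F x) v \<le> dist (F x) q"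
          using that aff by (intro closest_point_unique) (auto simp: affine_imp_convex affine_closed)
        then show ?thesis using True gK[OF True] closest_point_affine(2)[OF aff neE[OF True]]
          by (auto simp: g_def dist_commute)
      qed (simp add: g_def)
      ultimately show ?thesis by (simp add: sa_def)
    qed
    ultimately show ?case using gK by blast
  qed
  moreover have "aff_dim (K x) < int (DIM('b) + 1)" for x using aff_dim_le_DIM[of "K x"] by simp
  ultimately obtain f where "sa f" "continuous_on Q f" "\<forall>x\<in>Q. f x \<in> K x"
    using Q by blast
  then show ?thesis using that by blast
qed

section \<open>Linear systems as semialgebraic affine bundles\<close>

lemma affine_solutions:
  fixes A :: "real ^ 's ^ 'r"
  shows "affine {v. A *v v = c}"
proof -
  have "A *v (s *\<^sub>R v + t *\<^sub>R w) = c" if "A *v v = c" "A *v w = c" "s + t = 1" for v w and s t :: real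
    using that by (simp add: matrix_vector_right_distrib matrix_vector_mult_scaleR flip: scaleR_add_left)
  then show ?thesis by (auto simp: affine_def)
qed

lemma sa_family_solutions:
  fixes A :: "real ^ 'n \<Rightarrow> real ^ 's ^ 'r" and \<gamma> :: "real ^ 'n \<Rightarrow> real ^ 'r"
  assumes "\<And>i j. sa (\<lambda>x. A x $ i $ j)" "\<And>i. sa (\<lambda>x. \<gamma> x $ i)"
  shows "sa_family (\<lambda>x. {v. A x *v v = \<gamma> x})"
proof -
  have nth: "sa (\<lambda>z. (snd z :: real ^ 's) $ j)" for j
    unfolding cart_eq_inner_axis by (intro sa_inner_const sa_snd)
  have "semialgebraic {z. (\<Sum>j\<in>UNIV. A (fst z) $ i $ j * snd z $ j) = \<gamma> (fst z) $ i}" for i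
    by (intro semialgebraic_eq sa_sum sa_mult nth sa_compose[OF sa_fst assms(1)]
        sa_compose[OF sa_fst assms(2)] finite_class.finite_UNIV)
  then have "semialgebraic (- (\<Union>i. - {z. (\<Sum>j\<in>UNIV. A (fst z) $ i $ j * snd z $ j) = \<gamma> (fst z) $ i}))"
    by (intro semialgebraic.Compl semialgebraic_UN finite_class.finite_UNIV)
  moreover have "{z. snd z \<in> {v. A (fst z) *v v = \<gamma> (fst z)}}
     = - (\<Union>i. - {z. (\<Sum>j\<in>UNIV. A (fst z) $ i $ j * snd z $ j) = \<gamma> (fst z) $ i})"
    by (auto simp: vec_eq_iff matrix_vector_mult_def)
  ultimately show ?thesis by (simp add: sa_family_def)
qed

theorem mainTheorem2:
  fixes Q :: "(real ^ 'n) set"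
    and A :: "real ^ 'n \<Rightarrow> real ^ 's ^ 'r"
    and \<gamma> :: "real ^ 'n \<Rightarrow> real ^ 'r"
  assumes "compact Q" and "semialgebraic Q"
    and "\<And>i j. semialgebraic_on UNIV (\<lambda>x. A x $ i $ j)"
    and "\<And>i. semialgebraic_on UNIV (\<lambda>x. \<gamma> x $ i)"
  shows "(\<exists>\<phi> :: real ^ 'n \<Rightarrow> real ^ 's.
            continuous_on Q \<phi> \<and> semialgebraic_on Q \<phi> \<and> (\<forall>x\<in>Q. A x *v \<phi> x = \<gamma> x))
     \<longleftrightarrow> (\<exists>\<psi> :: real ^ 'n \<Rightarrow> real ^ 's.
            continuous_on Q \<psi> \<and> (\<forall>x\<in>Q. A x *v \<psi> x = \<gamma> x))"
proof
  assume "\<exists>\<psi> :: real ^ 'n \<Rightarrow> real ^ 's. continuous_on Q \<psi> \<and> (\<forall>x\<in>Q. A x *v \<psi> x = \<gamma> x)"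
  then obtain \<psi> :: "real ^ 'n \<Rightarrow> real ^ 's"
    where \<psi>: "continuous_on Q \<psi>" "\<And>x. x \<in> Q \<Longrightarrow> A x *v \<psi> x = \<gamma> x" by blast
  obtain K where K: "\<And>y. affine (K y)" "sa_family K" "\<And>x. K x \<subseteq> {v. A x *v v = \<gamma> x}"
    "\<And>x. x \<in> Q \<Longrightarrow> K x \<subseteq> liminf_set (near Q x) K"
    "\<And>\<psi> x. continuous_on Q \<psi> \<Longrightarrow> (\<And>x. x \<in> Q \<Longrightarrow> \<psi> x \<in> {v. A x *v v = \<gamma> x}) \<Longrightarrow> x \<in> Q \<Longrightarrow> \<psi> x \<in> K x"
    using glaeser_stable_family[OF affine_solutions sa_family_solutions[OF assms(3,4)] assms(2)]
    by metis
  \<comment> \<open>The continuous solution survives every refinement, so its values witness that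
    the stable fibres are nonempty.\<close>
  have "K x \<noteq> {}" if "x \<in> Q" for x
    using K(5)[OF \<psi>(1) _ that] \<psi>(2) by blast
  then obtain f where f: "sa f" "continuous_on Q f" "\<And>x. x \<in> Q \<Longrightarrow> f x \<in> K x"
    using semialgebraic_affine_selection[OF K(1,2,4) _ assms(1,2)] by blast
  have "semialgebraic_on Q f" using f(1) assms(2) by (rule semialgebraic_on_restrict)
  moreover have "A x *v f x = \<gamma> x" if "x \<in> Q" for x using f(3)[OF that] K(3)[of x] by blast
  ultimately show "\<exists>\<phi> :: real ^ 'n \<Rightarrow> real ^ 's.
      continuous_on Q \<phi> \<and> semialgebraic_on Q \<phi> \<and> (\<forall>x\<in>Q. A x *v \<phi> x = \<gamma> x)"
    using f(2) by blast
qed blast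

end
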